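(* Let $k$ be a countable field and $\Omega=\bigcup_{n\ge 1}\Omega_n$ a countable set of operation symbols, where the elements of $\Omega_n$ are $n$-ary. Every countably generated associative $\Omega$-algebra $A$ over $k$ can be embedded into a simple two-generated associative $\Omega$-algebra over $k$; that is, there exist a simple associative $\Omega$-algebra $\mathcal{A}$ generated as an $\Omega$-algebra by two elements and an injective homomorphism of associative $\Omega$-algebras $A\to\mathcal{A}$.
   Context: An associative $\Omega$-algebra over a field $k$ is an associative $k$-algebra $A$ (not required to have a unit) together with, for each $n\ge 1$ and each $\delta\in\Omega_n$, a $k$-multilinear map $\delta:A^n\to A$ (no further identities are imposed). Homomorphisms are $k$-algebra homomorphisms (not required to preserve units) commuting with all operations in $\Omega$. An associative $\Omega$-algebra is generated by a subset $Y$ if the smallest $k$-subalgebra (not necessarily unital) containing $Y$ and closed under all operations in $\Omega$ is the whole algebra; it is countably generated if generated by an at most countable set. An ideal of an associative $\Omega$-algebra $A$ is a two-sided ideal $I$ of the algebra $A$ such that $\delta(a_1,\dots,a_n)\in I$ whenever $\delta\in\Omega_n$ and at least one $a_i\in I$. An associative $\Omega$-algebra is simple if its multiplication is not identically zero and its only ideals are $0$ and itself. "Countable" means at most countable. *)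

theory Defs
  imports "HOL-Algebra.Module" "HOL-Library.Countable_Set"
begin

text \<open>
  Operation symbols are the elements of a set \<open>Om\<close> with an arity function \<open>ar\<close>; the set of
  \<open>n\<close>-ary symbols is \<open>{d \<in> Om. ar d = n}\<close>. An operation takes the list of its arguments; its values
  on lists of the wrong length or with entries outside the carrier are irrelevant.

  The algebras need not be unital. The record type below inherits a field
  \<open>one\<close> from the rings of HOL-Algebra, which is unconstrained and never used.
\<close>

record ('k, 'a, 'o) omega_algebra = "('k, 'a) module" +
  interp :: "'o \<Rightarrow> 'a list \<Rightarrow> 'a"

definition args :: "('a, 'm) partial_object_scheme \<Rightarrow> nat \<Rightarrow> 'a list set"
  where "args A n = {xs. length xs = n \<and> set xs \<subseteq> carrier A}"

locale omega_algebra = field K + module K A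
  for K :: "('k, 'm) ring_scheme" (structure)
    and Om :: "'o set" and ar :: "'o \<Rightarrow> nat"
    and A :: "('k, 'a, 'o, 'n) omega_algebra_scheme" (structure) +
  assumes mult_closed:
      "\<lbrakk>x \<in> carrier A; y \<in> carrier A\<rbrakk> \<Longrightarrow> x \<otimes>\<^bsub>A\<^esub> y \<in> carrier A"
    and mult_assoc:
      "\<lbrakk>x \<in> carrier A; y \<in> carrier A; z \<in> carrier A\<rbrakk> \<Longrightarrow>
       (x \<otimes>\<^bsub>A\<^esub> y) \<otimes>\<^bsub>A\<^esub> z = x \<otimes>\<^bsub>A\<^esub> (y \<otimes>\<^bsub>A\<^esub> z)"
    and mult_add_left:
      "\<lbrakk>x \<in> carrier A; y \<in> carrier A; z \<in> carrier A\<rbrakk> \<Longrightarrow>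
       (x \<oplus>\<^bsub>A\<^esub> y) \<otimes>\<^bsub>A\<^esub> z = (x \<otimes>\<^bsub>A\<^esub> z) \<oplus>\<^bsub>A\<^esub> (y \<otimes>\<^bsub>A\<^esub> z)"
    and mult_add_right:
      "\<lbrakk>x \<in> carrier A; y \<in> carrier A; z \<in> carrier A\<rbrakk> \<Longrightarrow>
       z \<otimes>\<^bsub>A\<^esub> (x \<oplus>\<^bsub>A\<^esub> y) = (z \<otimes>\<^bsub>A\<^esub> x) \<oplus>\<^bsub>A\<^esub> (z \<otimes>\<^bsub>A\<^esub> y)"
    and mult_smult_left:
      "\<lbrakk>c \<in> carrier K; x \<in> carrier A; y \<in> carrier A\<rbrakk> \<Longrightarrow>
       (c \<odot>\<^bsub>A\<^esub> x) \<otimes>\<^bsub>A\<^esub> y = c \<odot>\<^bsub>A\<^esub> (x \<otimes>\<^bsub>A\<^esub> y)"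
    and mult_smult_right:
      "\<lbrakk>c \<in> carrier K; x \<in> carrier A; y \<in> carrier A\<rbrakk> \<Longrightarrow>
       x \<otimes>\<^bsub>A\<^esub> (c \<odot>\<^bsub>A\<^esub> y) = c \<odot>\<^bsub>A\<^esub> (x \<otimes>\<^bsub>A\<^esub> y)"
    and interp_closed:
      "\<lbrakk>d \<in> Om; xs \<in> args A (ar d)\<rbrakk> \<Longrightarrow> interp A d xs \<in> carrier A"
    and interp_add:
      "\<lbrakk>d \<in> Om; xs \<in> args A (ar d); i < ar d; x \<in> carrier A; y \<in> carrier A\<rbrakk> \<Longrightarrow>
       interp A d (xs[i := x \<oplus>\<^bsub>A\<^esub> y]) = interp A d (xs[i := x]) \<oplus>\<^bsub>A\<^esub> interp A d (xs[i := y])"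
    and interp_smult:
      "\<lbrakk>d \<in> Om; xs \<in> args A (ar d); i < ar d; c \<in> carrier K; x \<in> carrier A\<rbrakk> \<Longrightarrow>
       interp A d (xs[i := c \<odot>\<^bsub>A\<^esub> x]) = c \<odot>\<^bsub>A\<^esub> interp A d (xs[i := x])"

definition omega_subalgebra ::
    "('k, 'm) ring_scheme \<Rightarrow> 'o set \<Rightarrow> ('o \<Rightarrow> nat) \<Rightarrow> ('k, 'a, 'o, 'n) omega_algebra_scheme
     \<Rightarrow> 'a set \<Rightarrow> bool"
  where "omega_subalgebra K Om ar A S \<longleftrightarrow>
    submodule S K A \<and>
    (\<forall>x\<in>S. \<forall>y\<in>S. x \<otimes>\<^bsub>A\<^esub> y \<in> S) \<and>
    (\<forall>d\<in>Om. \<forall>xs\<in>args A (ar d). set xs \<subseteq> S \<longrightarrow> interp A d xs \<in> S)"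

definition omega_span ::
    "('k, 'm) ring_scheme \<Rightarrow> 'o set \<Rightarrow> ('o \<Rightarrow> nat) \<Rightarrow> ('k, 'a, 'o, 'n) omega_algebra_scheme
     \<Rightarrow> 'a set \<Rightarrow> 'a set"
  where "omega_span K Om ar A Y = \<Inter>{S. omega_subalgebra K Om ar A S \<and> Y \<subseteq> S}"

definition omega_generates ::
    "('k, 'm) ring_scheme \<Rightarrow> 'o set \<Rightarrow> ('o \<Rightarrow> nat) \<Rightarrow> ('k, 'a, 'o, 'n) omega_algebra_scheme
     \<Rightarrow> 'a set \<Rightarrow> bool"
  where "omega_generates K Om ar A Y \<longleftrightarrow>
    Y \<subseteq> carrier A \<and> omega_span K Om ar A Y = carrier A"

definition countably_generated ::
    "('k, 'm) ring_scheme \<Rightarrow> 'o set \<Rightarrow> ('o \<Rightarrow> nat) \<Rightarrow> ('k, 'a, 'o, 'n) omega_algebra_scheme \<Rightarrow> bool"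
  where "countably_generated K Om ar A \<longleftrightarrow> (\<exists>Y. countable Y \<and> omega_generates K Om ar A Y)"

definition omega_ideal ::
    "('k, 'm) ring_scheme \<Rightarrow> 'o set \<Rightarrow> ('o \<Rightarrow> nat) \<Rightarrow> ('k, 'a, 'o, 'n) omega_algebra_scheme
     \<Rightarrow> 'a set \<Rightarrow> bool"
  where "omega_ideal K Om ar A I \<longleftrightarrow>
    submodule I K A \<and>
    (\<forall>x\<in>I. \<forall>a\<in>carrier A. a \<otimes>\<^bsub>A\<^esub> x \<in> I \<and> x \<otimes>\<^bsub>A\<^esub> a \<in> I) \<and>
    (\<forall>d\<in>Om. \<forall>xs\<in>args A (ar d). (\<exists>i<ar d. xs ! i \<in> I) \<longrightarrow> interp A d xs \<in> I)"

definition omega_simple ::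
    "('k, 'm) ring_scheme \<Rightarrow> 'o set \<Rightarrow> ('o \<Rightarrow> nat) \<Rightarrow> ('k, 'a, 'o, 'n) omega_algebra_scheme \<Rightarrow> bool"
  where "omega_simple K Om ar A \<longleftrightarrow>
    (\<exists>x\<in>carrier A. \<exists>y\<in>carrier A. x \<otimes>\<^bsub>A\<^esub> y \<noteq> \<zero>\<^bsub>A\<^esub>) \<and>
    (\<forall>I. omega_ideal K Om ar A I \<longrightarrow> I = {\<zero>\<^bsub>A\<^esub>} \<or> I = carrier A)"

definition omega_hom ::
    "('k, 'm) ring_scheme \<Rightarrow> 'o set \<Rightarrow> ('o \<Rightarrow> nat) \<Rightarrow> ('k, 'a, 'o, 'n) omega_algebra_scheme
     \<Rightarrow> ('k, 'b, 'o, 'p) omega_algebra_scheme \<Rightarrow> ('a \<Rightarrow> 'b) set"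
  where "omega_hom K Om ar A B = {h.
    (\<forall>x\<in>carrier A. h x \<in> carrier B) \<and>
    (\<forall>x\<in>carrier A. \<forall>y\<in>carrier A. h (x \<oplus>\<^bsub>A\<^esub> y) = h x \<oplus>\<^bsub>B\<^esub> h y) \<and>
    (\<forall>c\<in>carrier K. \<forall>x\<in>carrier A. h (c \<odot>\<^bsub>A\<^esub> x) = c \<odot>\<^bsub>B\<^esub> h x) \<and>
    (\<forall>x\<in>carrier A. \<forall>y\<in>carrier A. h (x \<otimes>\<^bsub>A\<^esub> y) = h x \<otimes>\<^bsub>B\<^esub> h y) \<and>
    (\<forall>d\<in>Om. \<forall>xs\<in>args A (ar d). h (interp A d xs) = interp B d (map h xs))}"

lemma (in omega_algebra) omega_subalgebra_span:
  assumes "Y \<subseteq> carrier A"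
  shows "omega_subalgebra K Om ar A (omega_span K Om ar A Y)"
proof -
  let ?F = "{S. omega_subalgebra K Om ar A S \<and> Y \<subseteq> S}"
  have "omega_subalgebra K Om ar A (carrier A)"
    by (simp add: omega_subalgebra_def carrier_is_submodule mult_closed interp_closed)
  with assms have carrier: "carrier A \<in> ?F" by simp
  have sub: "submodule S K A" if "S \<in> ?F" for S
    using that by (simp add: omega_subalgebra_def)
  have "submodule (\<Inter>?F) K A"
  proof (rule submoduleI)
    show "\<Inter>?F \<subseteq> carrier A" using carrier by blast
    show "\<zero>\<^bsub>A\<^esub> \<in> \<Inter>?F" using submoduleE(2) sub
      by (metis (no_types, lifting) InterI subgroup.one_closed submodule_def monoid.select_convs(2))
    show "\<And>a. a \<in> \<Inter>?F \<Longrightarrow> \<ominus>\<^bsub>A\<^esub> a \<in> \<Inter>?F"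
      using submoduleE(3)[OF sub] by blast
    show "\<And>a b. \<lbrakk>a \<in> \<Inter>?F; b \<in> \<Inter>?F\<rbrakk> \<Longrightarrow> a \<oplus>\<^bsub>A\<^esub> b \<in> \<Inter>?F"
      using submoduleE(5)[OF sub] by blast
    show "\<And>a x. \<lbrakk>a \<in> carrier K; x \<in> \<Inter>?F\<rbrakk> \<Longrightarrow> a \<odot>\<^bsub>A\<^esub> x \<in> \<Inter>?F"
      using submoduleE(4)[OF sub] by blast
  qed
  moreover have "\<forall>x\<in>\<Inter>?F. \<forall>y\<in>\<Inter>?F. x \<otimes>\<^bsub>A\<^esub> y \<in> \<Inter>?F"
    by (auto simp: omega_subalgebra_def)
  moreover have "interp A d xs \<in> \<Inter>?F"
    if "d \<in> Om" "xs \<in> args A (ar d)" "set xs \<subseteq> \<Inter>?F" for d xs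
  proof
    fix S assume S: "S \<in> ?F"
    with that(3) have "set xs \<subseteq> S" by blast
    with S that(1,2) show "interp A d xs \<in> S" by (simp add: omega_subalgebra_def)
  qed
  ultimately show ?thesis
    unfolding omega_span_def by (subst omega_subalgebra_def) blast
qed

end

theory Submission
  imports Defs "HOL-Library.Nat_Bijection"
begin

text \<open>
  Let \<open>V\<close> be the space of finitely supported sequences over the countable field \<open>k\<close>, and let \<open>E\<close> be its
  algebra of endomorphisms, written as column-finite matrices. The countable algebra \<open>A\<close> acts
  faithfully on \<open>V\<close>, with infinite multiplicity, so for each \<open>a \<noteq> 0\<close> in \<open>A\<close> there are
  \<open>b, c \<in> E\<close> with \<open>b a c = 1\<close>. A linear projection of \<open>E\<close> onto \<open>A\<close> extends the operations of \<open>A\<close>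
  to \<open>E\<close>. Any countable subset of \<open>E\<close> lies in a subalgebra with two generators; let \<open>C\<close> be
  a two-generated \<open>\<Omega>\<close>-subalgebra containing \<open>A\<close>, the unit and all those \<open>b, c\<close>. A
  maximal proper \<open>\<Omega>\<close>-ideal \<open>M\<close> of \<open>C\<close> meets \<open>A\<close> trivially, because a nonzero element of \<open>A\<close>
  generates the unit ideal. Hence \<open>A\<close> embeds into the simple \<open>\<Omega>\<close>-algebra \<open>C / M\<close>, which is
  countable and so can be carried by the natural numbers.
\<close>

section \<open>Linear maps and finitely supported vectors\<close>

definition linear_map ::
    "('k, 'm) ring_scheme \<Rightarrow> ('k, 'a, 'n) module_scheme \<Rightarrow> ('k, 'b, 'p) module_scheme
     \<Rightarrow> ('a \<Rightarrow> 'b) \<Rightarrow> bool"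
  where "linear_map K M N h \<longleftrightarrow>
    (\<forall>x\<in>carrier M. h x \<in> carrier N) \<and>
    (\<forall>x\<in>carrier M. \<forall>y\<in>carrier M. h (x \<oplus>\<^bsub>M\<^esub> y) = h x \<oplus>\<^bsub>N\<^esub> h y) \<and>
    (\<forall>c\<in>carrier K. \<forall>x\<in>carrier M. h (c \<odot>\<^bsub>M\<^esub> x) = c \<odot>\<^bsub>N\<^esub> h x)"

lemma linear_mapD:
  assumes "linear_map K M N h"
  shows linear_map_closed: "x \<in> carrier M \<Longrightarrow> h x \<in> carrier N"
    and linear_map_add: "x \<in> carrier M \<Longrightarrow> y \<in> carrier M \<Longrightarrow> h (x \<oplus>\<^bsub>M\<^esub> y) = h x \<oplus>\<^bsub>N\<^esub> h y"
    and linear_map_smult: "c \<in> carrier K \<Longrightarrow> x \<in> carrier M \<Longrightarrow> h (c \<odot>\<^bsub>M\<^esub> x) = c \<odot>\<^bsub>N\<^esub> h x"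
  using assms by (auto simp: linear_map_def)

lemma linear_map_zero:
  assumes "module K M" "module K N" "linear_map K M N h"
  shows "h \<zero>\<^bsub>M\<^esub> = \<zero>\<^bsub>N\<^esub>"
proof -
  interpret M: module K M by fact
  interpret N: module K N by fact
  have "h (\<zero>\<^bsub>K\<^esub> \<odot>\<^bsub>M\<^esub> \<zero>\<^bsub>M\<^esub>) = \<zero>\<^bsub>K\<^esub> \<odot>\<^bsub>N\<^esub> h \<zero>\<^bsub>M\<^esub>"
    using assms(3) by (intro linear_map_smult) auto
  then show ?thesis
    using linear_map_closed[OF assms(3), of "\<zero>\<^bsub>M\<^esub>"] by simp
qed

lemma linear_map_uminus:
  assumes "module K M" "module K N" "linear_map K M N h" "x \<in> carrier M"
  shows "h (\<ominus>\<^bsub>M\<^esub> x) = \<ominus>\<^bsub>N\<^esub> h x"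
proof -
  interpret M: module K M by fact
  interpret N: module K N by fact
  have "h (\<ominus>\<^bsub>M\<^esub> x) \<oplus>\<^bsub>N\<^esub> h x = \<zero>\<^bsub>N\<^esub>"
    using assms linear_map_zero[OF assms(1-3)] linear_map_add[OF assms(3), of "\<ominus>\<^bsub>M\<^esub> x" x]
    by (simp add: M.l_neg)
  then show ?thesis
    using assms(4) linear_map_closed[OF assms(3)] by (simp add: N.minus_equality)
qed

lemma linear_map_minus:
  assumes "module K M" "module K N" "linear_map K M N h" "x \<in> carrier M" "y \<in> carrier M"
  shows "h (x \<ominus>\<^bsub>M\<^esub> y) = h x \<ominus>\<^bsub>N\<^esub> h y"
proof -
  interpret M: module K M by fact
  show ?thesis
    using assms by (simp add: a_minus_def linear_map_add linear_map_uminus)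
qed

lemma linear_map_finsum:
  assumes "module K M" "module K N" "linear_map K M N h" "finite S" "f \<in> S \<rightarrow> carrier M"
  shows "h (finsum M f S) = finsum N (\<lambda>i. h (f i)) S"
proof -
  interpret M: module K M by fact
  interpret N: module K N by fact
  show ?thesis using assms(4,5)
  proof (induction S rule: finite_induct)
    case empty
    then show ?case using linear_map_zero[OF assms(1-3)] by simp
  next
    case (insert x F)
    then show ?case
      by (simp add: linear_map_add[OF assms(3)] linear_map_closed[OF assms(3)] Pi_def)
  qed
qed

definition vectors :: "('k, 'm) ring_scheme \<Rightarrow> ('k, nat \<Rightarrow> 'k) module"
  where "vectors K =
    \<lparr>carrier = {v. (\<forall>n. v n \<in> carrier K) \<and> finite {n. v n \<noteq> \<zero>\<^bsub>K\<^esub>}},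
     mult = (\<lambda>u v n. u n \<otimes>\<^bsub>K\<^esub> v n), one = (\<lambda>n. \<one>\<^bsub>K\<^esub>), zero = (\<lambda>n. \<zero>\<^bsub>K\<^esub>),
     add = (\<lambda>u v n. u n \<oplus>\<^bsub>K\<^esub> v n), smult = (\<lambda>c v n. c \<otimes>\<^bsub>K\<^esub> v n)\<rparr>"

lemma vectors_sel [simp]:
  "\<zero>\<^bsub>vectors K\<^esub> = (\<lambda>n. \<zero>\<^bsub>K\<^esub>)"
  "u \<oplus>\<^bsub>vectors K\<^esub> v = (\<lambda>n. u n \<oplus>\<^bsub>K\<^esub> v n)"
  "c \<odot>\<^bsub>vectors K\<^esub> v = (\<lambda>n. c \<otimes>\<^bsub>K\<^esub> v n)"
  by (simp_all add: vectors_def)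

lemma vectors_carrier:
  "v \<in> carrier (vectors K) \<longleftrightarrow> (\<forall>n. v n \<in> carrier K) \<and> finite {n. v n \<noteq> \<zero>\<^bsub>K\<^esub>}"
  by (simp add: vectors_def)

lemma (in cring) vectors_module: "module R (vectors R)"
proof (intro module.intro abelian_groupI module_axioms.intro)
  let ?V = "vectors R"
  show "cring R" ..
  show "x \<oplus>\<^bsub>?V\<^esub> y \<in> carrier ?V" if "x \<in> carrier ?V" "y \<in> carrier ?V" for x y
  proof -
    have "{n. x n \<oplus> y n \<noteq> \<zero>} \<subseteq> {n. x n \<noteq> \<zero>} \<union> {n. y n \<noteq> \<zero>}" by auto
    with that show ?thesis by (auto simp: vectors_carrier intro: finite_subset)
  qed
  have smult: "c \<odot>\<^bsub>?V\<^esub> x \<in> carrier ?V" if "c \<in> carrier R" "x \<in> carrier ?V" for c x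
  proof -
    have "{n. c \<otimes> x n \<noteq> \<zero>} \<subseteq> {n. x n \<noteq> \<zero>}" using that by auto
    with that show ?thesis by (auto simp: vectors_carrier intro: finite_subset)
  qed
  show "c \<odot>\<^bsub>?V\<^esub> x \<in> carrier ?V" if "c \<in> carrier R" "x \<in> carrier ?V" for c x
    using that by (rule smult)
  show "\<exists>y\<in>carrier ?V. y \<oplus>\<^bsub>?V\<^esub> x = \<zero>\<^bsub>?V\<^esub>" if "x \<in> carrier ?V" for x
  proof
    show "(\<ominus> \<one>) \<odot>\<^bsub>?V\<^esub> x \<in> carrier ?V" using that by (intro smult) auto
    show "(\<ominus> \<one>) \<odot>\<^bsub>?V\<^esub> x \<oplus>\<^bsub>?V\<^esub> x = \<zero>\<^bsub>?V\<^esub>"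
      using that by (auto simp: vectors_carrier l_minus l_neg)
  qed
qed (auto simp: vectors_carrier a_ac m_assoc l_distr r_distr)

definition unit_vec :: "('k, 'm) ring_scheme \<Rightarrow> nat \<Rightarrow> nat \<Rightarrow> 'k"
  where "unit_vec K n = (\<lambda>m. if m = n then \<one>\<^bsub>K\<^esub> else \<zero>\<^bsub>K\<^esub>)"

lemma (in cring) unit_vec_closed [simp]: "unit_vec R n \<in> carrier (vectors R)"
proof -
  have "{m. unit_vec R n m \<noteq> \<zero>} \<subseteq> {n}" by (auto simp: unit_vec_def)
  then have "finite {m. unit_vec R n m \<noteq> \<zero>}" by (rule finite_subset) simp
  then show ?thesis by (simp add: vectors_carrier unit_vec_def)
qed

definition lincomb ::
    "('k, 'm) ring_scheme \<Rightarrow> ('k, 'a, 'n) module_scheme \<Rightarrow> (nat \<Rightarrow> 'a) \<Rightarrow> (nat \<Rightarrow> 'k) \<Rightarrow> 'a"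
  where "lincomb K M g v = (\<Oplus>\<^bsub>M\<^esub>n\<in>{n. v n \<noteq> \<zero>\<^bsub>K\<^esub>}. v n \<odot>\<^bsub>M\<^esub> g n)"

context module
begin

lemma lincomb_superset:
  assumes g: "\<And>n. g n \<in> carrier M" and v: "v \<in> carrier (vectors R)"
    and S: "finite S" "{n. v n \<noteq> \<zero>} \<subseteq> S"
  shows "lincomb R M g v = (\<Oplus>\<^bsub>M\<^esub>n\<in>S. v n \<odot>\<^bsub>M\<^esub> g n)"
  unfolding lincomb_def using S g v
  by (intro M.add.finprod_mono_neutral_cong_left) (auto simp: vectors_carrier)

lemma lincomb_linear:
  assumes g: "\<And>n. g n \<in> carrier M"
  shows "linear_map R (vectors R) M (lincomb R M g)"
proof -
  interpret V: module R "vectors R" by (rule R.vectors_module)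
  have "lincomb R M g v \<in> carrier M" if "v \<in> carrier (vectors R)" for v
    using that g unfolding lincomb_def by (intro M.finsum_closed) (auto simp: vectors_carrier)
  moreover have "lincomb R M g (u \<oplus>\<^bsub>vectors R\<^esub> v) = lincomb R M g u \<oplus>\<^bsub>M\<^esub> lincomb R M g v"
    if u: "u \<in> carrier (vectors R)" and v: "v \<in> carrier (vectors R)" for u v
  proof -
    let ?S = "{n. u n \<noteq> \<zero>} \<union> {n. v n \<noteq> \<zero>}"
    have fin: "finite ?S" using u v by (simp add: vectors_carrier)
    have "lincomb R M g (u \<oplus>\<^bsub>vectors R\<^esub> v) = (\<Oplus>\<^bsub>M\<^esub>n\<in>?S. (u \<oplus>\<^bsub>vectors R\<^esub> v) n \<odot>\<^bsub>M\<^esub> g n)"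
      using u v by (intro lincomb_superset[OF g V.M.add.m_closed fin]) (auto simp: vectors_carrier)
    also have "\<dots> = (\<Oplus>\<^bsub>M\<^esub>n\<in>?S. u n \<odot>\<^bsub>M\<^esub> g n \<oplus>\<^bsub>M\<^esub> v n \<odot>\<^bsub>M\<^esub> g n)"
      using u v g by (intro M.finsum_cong') (auto simp: vectors_carrier smult_l_distr)
    also have "\<dots> = (\<Oplus>\<^bsub>M\<^esub>n\<in>?S. u n \<odot>\<^bsub>M\<^esub> g n) \<oplus>\<^bsub>M\<^esub> (\<Oplus>\<^bsub>M\<^esub>n\<in>?S. v n \<odot>\<^bsub>M\<^esub> g n)"
      using u v g by (intro M.finsum_addf) (auto simp: vectors_carrier)
    also have "\<dots> = lincomb R M g u \<oplus>\<^bsub>M\<^esub> lincomb R M g v"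
      using u v by (simp add: lincomb_superset[OF g _ fin])
    finally show ?thesis .
  qed
  moreover have "lincomb R M g (c \<odot>\<^bsub>vectors R\<^esub> v) = c \<odot>\<^bsub>M\<^esub> lincomb R M g v"
    if c: "c \<in> carrier R" and v: "v \<in> carrier (vectors R)" for c v
  proof -
    let ?S = "{n. v n \<noteq> \<zero>}"
    have fin: "finite ?S" using v by (simp add: vectors_carrier)
    have "lincomb R M g (c \<odot>\<^bsub>vectors R\<^esub> v) = (\<Oplus>\<^bsub>M\<^esub>n\<in>?S. (c \<odot>\<^bsub>vectors R\<^esub> v) n \<odot>\<^bsub>M\<^esub> g n)"
      using c v by (intro lincomb_superset[OF g V.smult_closed fin]) (auto simp: vectors_carrier)
    also have "\<dots> = (\<Oplus>\<^bsub>M\<^esub>n\<in>?S. c \<odot>\<^bsub>M\<^esub> (v n \<odot>\<^bsub>M\<^esub> g n))"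
      using c v g by (intro M.finsum_cong') (auto simp: vectors_carrier smult_assoc1)
    also have "\<dots> = c \<odot>\<^bsub>M\<^esub> lincomb R M g v"
      unfolding lincomb_def using c v g fin
      by (intro finsum_smult_ldistr[symmetric]) (auto simp: vectors_carrier)
    finally show ?thesis .
  qed
  ultimately show ?thesis unfolding linear_map_def by blast
qed

lemmas lincomb_closed [simp] = linear_map_closed[OF lincomb_linear]

lemma lincomb_unit_vec [simp]:
  assumes g: "\<And>n. g n \<in> carrier M"
  shows "lincomb R M g (unit_vec R n) = g n"
proof -
  have "lincomb R M g (unit_vec R n) = (\<Oplus>\<^bsub>M\<^esub>m\<in>{n}. unit_vec R n m \<odot>\<^bsub>M\<^esub> g m)"
    by (rule lincomb_superset[OF g R.unit_vec_closed]) (auto simp: unit_vec_def)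
  also have "\<dots> = g n" by (simp add: g unit_vec_def)
  finally show ?thesis .
qed

lemma linear_map_lincomb:
  assumes N: "module R N" and h: "linear_map R M N h"
    and g: "\<And>n. g n \<in> carrier M" and v: "v \<in> carrier (vectors R)"
  shows "h (lincomb R M g v) = lincomb R N (\<lambda>n. h (g n)) v"
proof -
  interpret N: module R N by fact
  have "h (lincomb R M g v) = (\<Oplus>\<^bsub>N\<^esub>n\<in>{n. v n \<noteq> \<zero>}. h (v n \<odot>\<^bsub>M\<^esub> g n))"
    unfolding lincomb_def using v g
    by (intro linear_map_finsum[OF module_axioms N h]) (auto simp: vectors_carrier)
  also have "\<dots> = lincomb R N (\<lambda>n. h (g n)) v"
    unfolding lincomb_def using v g linear_map_closed[OF h]
    by (intro N.M.finsum_cong') (auto simp: vectors_carrier linear_map_smult[OF h])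
  finally show ?thesis .
qed

lemma lincomb_add:
  assumes f: "\<And>n. f n \<in> carrier M" and g: "\<And>n. g n \<in> carrier M" and v: "v \<in> carrier (vectors R)"
  shows "lincomb R M (\<lambda>n. f n \<oplus>\<^bsub>M\<^esub> g n) v = lincomb R M f v \<oplus>\<^bsub>M\<^esub> lincomb R M g v"
proof -
  have "lincomb R M (\<lambda>n. f n \<oplus>\<^bsub>M\<^esub> g n) v
      = (\<Oplus>\<^bsub>M\<^esub>n\<in>{n. v n \<noteq> \<zero>}. v n \<odot>\<^bsub>M\<^esub> f n \<oplus>\<^bsub>M\<^esub> v n \<odot>\<^bsub>M\<^esub> g n)"
    unfolding lincomb_def using assms
    by (intro M.finsum_cong') (auto simp: vectors_carrier smult_r_distr)
  also have "\<dots> = lincomb R M f v \<oplus>\<^bsub>M\<^esub> lincomb R M g v"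
    unfolding lincomb_def using assms by (intro M.finsum_addf) (auto simp: vectors_carrier)
  finally show ?thesis .
qed

lemma smult_linear: "c \<in> carrier R \<Longrightarrow> linear_map R M M (\<lambda>x. c \<odot>\<^bsub>M\<^esub> x)"
  unfolding linear_map_def by (auto simp: smult_r_distr smult_assoc1[symmetric] R.m_comm)

lemma lincomb_smult:
  assumes "c \<in> carrier R" "\<And>n. g n \<in> carrier M" "v \<in> carrier (vectors R)"
  shows "lincomb R M (\<lambda>n. c \<odot>\<^bsub>M\<^esub> g n) v = c \<odot>\<^bsub>M\<^esub> lincomb R M g v"
  using linear_map_lincomb[OF module_axioms smult_linear] assms by simp

end

lemma (in abelian_group) minus_eq_zero_iff:
  "x \<in> carrier G \<Longrightarrow> y \<in> carrier G \<Longrightarrow> x \<ominus> y = \<zero> \<longleftrightarrow> x = y"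
  using minus_equality[of x "\<ominus> y"] by (auto simp: a_minus_def r_neg)

lemma (in abelian_group) diff_zero: "x \<in> carrier G \<Longrightarrow> x \<ominus> \<zero> = x"
  using minus_equality[of \<zero> \<zero>] by (simp add: a_minus_def)

lemma (in abelian_group) minus_add_cancel:
  assumes "x \<in> carrier G" "y \<in> carrier G" "z \<in> carrier G"
  shows "(x \<ominus> y) \<oplus> (y \<ominus> z) = x \<ominus> z"
  using assms by (simp add: a_minus_def a_assoc r_neg1)

lemma (in module) submodule_zero: "submodule H R M \<Longrightarrow> \<zero>\<^bsub>M\<^esub> \<in> H"
  using subgroup.one_closed[OF submodule.axioms(1)] by fastforce

lemma (in module) submodule_Union_chain:
  assumes ne: "\<C> \<noteq> {}" and chain: "subset.chain \<A> \<C>" and sub: "\<And>H. H \<in> \<C> \<Longrightarrow> submodule H R M"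
  shows "submodule (\<Union>\<C>) R M"
proof (rule submoduleI)
  show "\<Union>\<C> \<subseteq> carrier M" using submoduleE(1)[OF sub] by blast
  show "\<zero>\<^bsub>M\<^esub> \<in> \<Union>\<C>" using ne submodule_zero[OF sub] by blast
  show "\<ominus>\<^bsub>M\<^esub> a \<in> \<Union>\<C>" if "a \<in> \<Union>\<C>" for a using that submoduleE(3)[OF sub] by blast
  show "a \<oplus>\<^bsub>M\<^esub> b \<in> \<Union>\<C>" if "a \<in> \<Union>\<C>" "b \<in> \<Union>\<C>" for a b
  proof -
    from that obtain H H' where H: "H \<in> \<C>" "H' \<in> \<C>" "a \<in> H" "b \<in> H'" by blast
    with chain have "H \<subseteq> H' \<or> H' \<subseteq> H" by (auto simp: subset_chain_def)
    with H submoduleE(5)[OF sub] show ?thesis by blast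
  qed
  show "c \<odot>\<^bsub>M\<^esub> x \<in> \<Union>\<C>" if "c \<in> carrier R" "x \<in> \<Union>\<C>" for c x
    using that submoduleE(4)[OF sub] by blast
qed

text \<open>A maximal submodule \<open>T\<close> meeting the kernel of \<open>lincomb K M w\<close> trivially is mapped bijectively onto \<open>M\<close>.\<close>

lemma linear_section:
  assumes K: "field K" and M: "module K M"
    and w: "\<And>n. w n \<in> carrier M" and surj: "carrier M \<subseteq> range w"
  obtains r where "linear_map K M (vectors K) r"
    and "\<And>x. x \<in> carrier M \<Longrightarrow> lincomb K M w (r x) = x"
proof -
  note [simp del] = vectors_sel
  let ?V = "vectors K" and ?s = "lincomb K M w"
  interpret K: field K by fact
  interpret M: module K M by fact
  interpret V: module K ?V by (rule K.vectors_module)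
  have s: "linear_map K ?V M ?s" using w by (rule M.lincomb_linear)
  define \<A> where "\<A> = {T. submodule T K ?V \<and> (\<forall>v\<in>T. ?s v = \<zero>\<^bsub>M\<^esub> \<longrightarrow> v = \<zero>\<^bsub>?V\<^esub>)}"
  have "submodule {\<zero>\<^bsub>?V\<^esub>} K ?V"
    by (rule V.submoduleI) (auto )
  then have "\<A> \<noteq> {}" unfolding \<A>_def by blast
  moreover have "\<Union>\<C> \<in> \<A>" if "\<C> \<noteq> {}" "subset.chain \<A> \<C>" for \<C>
  proof -
    have "\<C> \<subseteq> \<A>" using that(2) by (auto simp: subset_chain_def)
    then have "submodule (\<Union>\<C>) K ?V"
      by (intro V.submodule_Union_chain[OF that]) (auto simp: \<A>_def)
    with \<open>\<C> \<subseteq> \<A>\<close> show ?thesis unfolding \<A>_def by blast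
  qed
  ultimately obtain T where "T \<in> \<A>" and max: "\<And>X. X \<in> \<A> \<Longrightarrow> T \<subseteq> X \<Longrightarrow> X = T"
    using subset_Zorn_nonempty[of \<A>] by metis
  then have T: "submodule T K ?V" and T0: "\<And>v. v \<in> T \<Longrightarrow> ?s v = \<zero>\<^bsub>M\<^esub> \<Longrightarrow> v = \<zero>\<^bsub>?V\<^esub>"
    by (auto simp: \<A>_def)
  note TE = V.submoduleE[OF T]
  have onto: "\<exists>t\<in>T. ?s t = x" if x: "x \<in> carrier M" for x
  proof (rule ccontr)
    assume neg: "\<not> (\<exists>t\<in>T. ?s t = x)"
    from x surj obtain n where n: "x = w n" by blast
    let ?d = "unit_vec K n"
    let ?T = "{t \<oplus>\<^bsub>?V\<^esub> c \<odot>\<^bsub>?V\<^esub> ?d |t c. t \<in> T \<and> c \<in> carrier K}"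
    have Tc: "t \<in> carrier ?V" if "t \<in> T" for t using TE(1) that by blast
    have "submodule ?T K ?V"
    proof (rule V.submoduleI)
      show "?T \<subseteq> carrier ?V" using Tc by auto
      show "\<zero>\<^bsub>?V\<^esub> \<in> ?T"
        using V.submodule_zero[OF T] by (intro CollectI exI[of _ "\<zero>\<^bsub>?V\<^esub>"] exI[of _ "\<zero>\<^bsub>K\<^esub>"]) auto
      show "\<ominus>\<^bsub>?V\<^esub> a \<in> ?T" if "a \<in> ?T" for a
      proof -
        from that obtain t c where a: "a = t \<oplus>\<^bsub>?V\<^esub> c \<odot>\<^bsub>?V\<^esub> ?d" "t \<in> T" "c \<in> carrier K" by blast
        then have "\<ominus>\<^bsub>?V\<^esub> a = \<ominus>\<^bsub>?V\<^esub> t \<oplus>\<^bsub>?V\<^esub> (\<ominus>\<^bsub>K\<^esub> c) \<odot>\<^bsub>?V\<^esub> ?d"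
          using Tc by (simp add: V.M.minus_add V.smult_l_minus)
        with a TE(3) show ?thesis by blast
      qed
      show "a \<oplus>\<^bsub>?V\<^esub> b \<in> ?T" if "a \<in> ?T" "b \<in> ?T" for a b
      proof -
        from that obtain t c t' c' where a: "a = t \<oplus>\<^bsub>?V\<^esub> c \<odot>\<^bsub>?V\<^esub> ?d" "t \<in> T" "c \<in> carrier K"
          "b = t' \<oplus>\<^bsub>?V\<^esub> c' \<odot>\<^bsub>?V\<^esub> ?d" "t' \<in> T" "c' \<in> carrier K" by blast
        then have "a \<oplus>\<^bsub>?V\<^esub> b = (t \<oplus>\<^bsub>?V\<^esub> t') \<oplus>\<^bsub>?V\<^esub> (c \<oplus>\<^bsub>K\<^esub> c') \<odot>\<^bsub>?V\<^esub> ?d"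
          using Tc by (simp add: V.M.a_ac V.smult_l_distr)
        moreover have "t \<oplus>\<^bsub>?V\<^esub> t' \<in> T" "c \<oplus>\<^bsub>K\<^esub> c' \<in> carrier K" using a TE(5) by auto
        ultimately show ?thesis by blast
      qed
      show "b \<odot>\<^bsub>?V\<^esub> a \<in> ?T" if b: "b \<in> carrier K" and "a \<in> ?T" for a b
      proof -
        from that obtain t c where a: "a = t \<oplus>\<^bsub>?V\<^esub> c \<odot>\<^bsub>?V\<^esub> ?d" "t \<in> T" "c \<in> carrier K" by blast
        then have "b \<odot>\<^bsub>?V\<^esub> a = b \<odot>\<^bsub>?V\<^esub> t \<oplus>\<^bsub>?V\<^esub> (b \<otimes>\<^bsub>K\<^esub> c) \<odot>\<^bsub>?V\<^esub> ?d"
          using Tc b by (simp add: V.smult_r_distr V.smult_assoc1)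
        moreover have "b \<odot>\<^bsub>?V\<^esub> t \<in> T" "b \<otimes>\<^bsub>K\<^esub> c \<in> carrier K" using a b TE(4) by auto
        ultimately show ?thesis by blast
      qed
    qed
    moreover have "v = \<zero>\<^bsub>?V\<^esub>" if "v \<in> ?T" and v0: "?s v = \<zero>\<^bsub>M\<^esub>" for v
    proof -
      from that obtain t c where v: "v = t \<oplus>\<^bsub>?V\<^esub> c \<odot>\<^bsub>?V\<^esub> ?d" and t: "t \<in> T" and c: "c \<in> carrier K"
        by blast
      have tc: "t \<in> carrier ?V" and sc: "?s t \<in> carrier M"
        using Tc[OF t] linear_map_closed[OF s] by auto
      have *: "?s t \<oplus>\<^bsub>M\<^esub> c \<odot>\<^bsub>M\<^esub> x = \<zero>\<^bsub>M\<^esub>"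
        using v0 tc c w by (simp add: v n linear_map_add[OF s] linear_map_smult[OF s])
      have "c = \<zero>\<^bsub>K\<^esub>"
      proof (rule ccontr)
        assume "c \<noteq> \<zero>\<^bsub>K\<^esub>"
        then have ci: "inv\<^bsub>K\<^esub> c \<in> carrier K" "inv\<^bsub>K\<^esub> c \<otimes>\<^bsub>K\<^esub> c = \<one>\<^bsub>K\<^esub>"
          using c K.field_Units by (auto intro: K.Units_inv_closed K.Units_l_inv)
        let ?t = "\<ominus>\<^bsub>?V\<^esub> (inv\<^bsub>K\<^esub> c \<odot>\<^bsub>?V\<^esub> t)"
        have "inv\<^bsub>K\<^esub> c \<odot>\<^bsub>M\<^esub> (?s t \<oplus>\<^bsub>M\<^esub> c \<odot>\<^bsub>M\<^esub> x) = \<zero>\<^bsub>M\<^esub>" using * ci by simp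
        then have "inv\<^bsub>K\<^esub> c \<odot>\<^bsub>M\<^esub> ?s t \<oplus>\<^bsub>M\<^esub> x = \<zero>\<^bsub>M\<^esub>"
          using c x sc ci by (simp add: M.smult_r_distr M.smult_assoc1[symmetric])
        then have "x = \<ominus>\<^bsub>M\<^esub> (inv\<^bsub>K\<^esub> c \<odot>\<^bsub>M\<^esub> ?s t)"
          using x sc ci by (metis M.M.a_comm M.M.minus_equality M.smult_closed)
        also have "\<dots> = ?s ?t"
          using ci tc by (simp add: linear_map_uminus[OF V.module_axioms M s] linear_map_smult[OF s])
        finally show False using neg TE(3,4) t ci by metis
      qed
      with * x sc t have "t = \<zero>\<^bsub>?V\<^esub>" by (intro T0) auto
      with \<open>c = \<zero>\<^bsub>K\<^esub>\<close> show ?thesis by (simp add: v)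
    qed
    ultimately have "?T \<in> \<A>" unfolding \<A>_def by blast
    moreover have "T \<subseteq> ?T"
    proof
      fix t assume "t \<in> T"
      then show "t \<in> ?T" using Tc by (intro CollectI exI[of _ t] exI[of _ "\<zero>\<^bsub>K\<^esub>"]) auto
    qed
    ultimately have "?T = T" by (rule max)
    moreover have "?d \<in> ?T"
      using V.submodule_zero[OF T] V.smult_one
      by (intro CollectI exI[of _ "\<zero>\<^bsub>?V\<^esub>"] exI[of _ "\<one>\<^bsub>K\<^esub>"]) auto
    ultimately have "?d \<in> T" by simp
    with neg w n show False by auto
  qed
  have inj: "t = t'" if "t \<in> T" "t' \<in> T" "?s t = ?s t'" for t t'
  proof -
    have c: "t \<in> carrier ?V" "t' \<in> carrier ?V" using that TE(1) by auto
    have "?s (t \<ominus>\<^bsub>?V\<^esub> t') = \<zero>\<^bsub>M\<^esub>"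
      using c that linear_map_closed[OF s]
      by (subst linear_map_minus[OF V.module_axioms M s]) (auto simp: M.M.r_neg a_minus_def)
    moreover have "t \<ominus>\<^bsub>?V\<^esub> t' \<in> T" using that TE(3,5) by (simp add: a_minus_def)
    ultimately show ?thesis
      using T0 V.M.minus_eq_zero_iff[OF c] by metis
  qed
  define r where "r x = (SOME t. t \<in> T \<and> ?s t = x)" for x
  have "r x \<in> T \<and> ?s (r x) = x" if "x \<in> carrier M" for x
    unfolding r_def using someI_ex[of "\<lambda>t. t \<in> T \<and> ?s t = x"] onto[OF that] by blast
  then have rT: "r x \<in> T" and sr: "?s (r x) = x" if "x \<in> carrier M" for x
    using that by auto
  have rc: "r x \<in> carrier ?V" if "x \<in> carrier M" for x
    using rT[OF that] TE(1) by blast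
  have "linear_map K M ?V r"
    unfolding linear_map_def
  proof (intro conjI ballI)
    show "r x \<in> carrier ?V" if "x \<in> carrier M" for x using that by (rule rc)
    show "r (x \<oplus>\<^bsub>M\<^esub> y) = r x \<oplus>\<^bsub>?V\<^esub> r y" if xy: "x \<in> carrier M" "y \<in> carrier M" for x y
    proof (rule inj)
      show "r (x \<oplus>\<^bsub>M\<^esub> y) \<in> T" using xy by (simp add: rT)
      show "r x \<oplus>\<^bsub>?V\<^esub> r y \<in> T" using xy by (simp add: rT TE(5))
      show "?s (r (x \<oplus>\<^bsub>M\<^esub> y)) = ?s (r x \<oplus>\<^bsub>?V\<^esub> r y)"
        using xy by (simp add: sr rc linear_map_add[OF s])
    qed
    show "r (c \<odot>\<^bsub>M\<^esub> x) = c \<odot>\<^bsub>?V\<^esub> r x" if cx: "c \<in> carrier K" "x \<in> carrier M" for x c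
    proof (rule inj)
      show "r (c \<odot>\<^bsub>M\<^esub> x) \<in> T" using cx by (simp add: rT)
      show "c \<odot>\<^bsub>?V\<^esub> r x \<in> T" using cx by (simp add: rT TE(4))
      show "?s (r (c \<odot>\<^bsub>M\<^esub> x)) = ?s (c \<odot>\<^bsub>?V\<^esub> r x)"
        using cx by (simp add: sr rc linear_map_smult[OF s])
    qed
  qed
  then show ?thesis using sr by (rule that)
qed

section \<open>Column-finite matrices\<close>

text \<open>A matrix \<open>f\<close> is given by its columns: \<open>f n\<close> is the image of the \<open>n\<close>-th unit vector.\<close>

definition matrices ::
    "('k, 'm) ring_scheme \<Rightarrow> ('o \<Rightarrow> (nat \<Rightarrow> nat \<Rightarrow> 'k) list \<Rightarrow> nat \<Rightarrow> nat \<Rightarrow> 'k)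
     \<Rightarrow> ('k, nat \<Rightarrow> nat \<Rightarrow> 'k, 'o) omega_algebra"
  where "matrices K ops =
    \<lparr>carrier = {f. \<forall>n. f n \<in> carrier (vectors K)},
     mult = (\<lambda>f g n. lincomb K (vectors K) f (g n)), one = unit_vec K,
     zero = (\<lambda>n. \<zero>\<^bsub>vectors K\<^esub>), add = (\<lambda>f g n. f n \<oplus>\<^bsub>vectors K\<^esub> g n),
     smult = (\<lambda>c f n. c \<odot>\<^bsub>vectors K\<^esub> f n), interp = ops\<rparr>"

lemma matrices_sel [simp]:
  "f \<otimes>\<^bsub>matrices K ops\<^esub> g = (\<lambda>n. lincomb K (vectors K) f (g n))"
  "\<one>\<^bsub>matrices K ops\<^esub> = unit_vec K"
  "\<zero>\<^bsub>matrices K ops\<^esub> = (\<lambda>n. \<zero>\<^bsub>vectors K\<^esub>)"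
  "f \<oplus>\<^bsub>matrices K ops\<^esub> g = (\<lambda>n. f n \<oplus>\<^bsub>vectors K\<^esub> g n)"
  "c \<odot>\<^bsub>matrices K ops\<^esub> f = (\<lambda>n. c \<odot>\<^bsub>vectors K\<^esub> f n)"
  "interp (matrices K ops) = ops"
  by (simp_all add: matrices_def)

lemma matrices_carrier: "f \<in> carrier (matrices K ops) \<longleftrightarrow> (\<forall>n. f n \<in> carrier (vectors K))"
  by (simp add: matrices_def)

context cring
begin

declare vectors_sel [simp del]

lemma matrices_module: "module R (matrices R ops)"
proof -
  interpret V: module R "vectors R" by (rule vectors_module)
  let ?E = "matrices R ops"
  show ?thesis
  proof (intro module.intro abelian_groupI module_axioms.intro)
    show "cring R" ..
    show "\<exists>y\<in>carrier ?E. y \<oplus>\<^bsub>?E\<^esub> x = \<zero>\<^bsub>?E\<^esub>" if "x \<in> carrier ?E" for x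
      using that
      by (intro bexI[of _ "\<lambda>n. \<ominus>\<^bsub>vectors R\<^esub> x n"]) (auto simp: matrices_carrier V.M.l_neg)
  qed (auto simp: matrices_carrier V.M.a_ac V.smult_l_distr V.smult_r_distr V.smult_assoc1)
qed

lemma matrices_mult_assoc:
  assumes "f \<in> carrier (matrices R ops)" "g \<in> carrier (matrices R ops)" "h \<in> carrier (matrices R ops)"
  shows "f \<otimes>\<^bsub>matrices R ops\<^esub> g \<otimes>\<^bsub>matrices R ops\<^esub> h
    = f \<otimes>\<^bsub>matrices R ops\<^esub> (g \<otimes>\<^bsub>matrices R ops\<^esub> h)"
proof -
  interpret V: module R "vectors R" by (rule vectors_module)
  show ?thesis
    using assms
    by (auto simp: matrices_carrier
        V.linear_map_lincomb[OF vectors_module V.lincomb_linear, of _ "\<lambda>n. _ n"])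
qed

end

lemma matrices_omega_algebra:
  fixes K :: "('k, 'm) ring_scheme" and Om :: "'o set" and ar :: "'o \<Rightarrow> nat"
  assumes K: "field K"
    and closed: "\<And>d xs. d \<in> Om \<Longrightarrow> xs \<in> args (matrices K ops) (ar d) \<Longrightarrow>
      ops d xs \<in> carrier (matrices K ops)"
    and add: "\<And>d xs i x y. d \<in> Om \<Longrightarrow> xs \<in> args (matrices K ops) (ar d) \<Longrightarrow> i < ar d \<Longrightarrow>
      x \<in> carrier (matrices K ops) \<Longrightarrow> y \<in> carrier (matrices K ops) \<Longrightarrow>
      ops d (xs[i := x \<oplus>\<^bsub>matrices K ops\<^esub> y])
        = ops d (xs[i := x]) \<oplus>\<^bsub>matrices K ops\<^esub> ops d (xs[i := y])"
    and smult: "\<And>d xs i c x. d \<in> Om \<Longrightarrow> xs \<in> args (matrices K ops) (ar d) \<Longrightarrow> i < ar d \<Longrightarrow>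
      c \<in> carrier K \<Longrightarrow> x \<in> carrier (matrices K ops) \<Longrightarrow>
      ops d (xs[i := c \<odot>\<^bsub>matrices K ops\<^esub> x]) = c \<odot>\<^bsub>matrices K ops\<^esub> ops d (xs[i := x])"
  shows "omega_algebra K Om ar (matrices K ops)"
proof -
  interpret K: field K by fact
  interpret V: module K "vectors K" by (rule K.vectors_module)
  let ?E = "matrices K ops"
  note [simp del] = vectors_sel
  show ?thesis
  proof (intro omega_algebra.intro omega_algebra_axioms.intro)
    show "field K" by fact
    show "module K ?E" by (rule K.matrices_module)
    fix x y z :: "nat \<Rightarrow> nat \<Rightarrow> 'k" and c
    show "x \<otimes>\<^bsub>?E\<^esub> y \<in> carrier ?E" if "x \<in> carrier ?E" "y \<in> carrier ?E"
      using that by (auto simp: matrices_carrier)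
    show "x \<otimes>\<^bsub>?E\<^esub> y \<otimes>\<^bsub>?E\<^esub> z = x \<otimes>\<^bsub>?E\<^esub> (y \<otimes>\<^bsub>?E\<^esub> z)"
      if "x \<in> carrier ?E" "y \<in> carrier ?E" "z \<in> carrier ?E"
      using that by (rule K.matrices_mult_assoc)
    show "(x \<oplus>\<^bsub>?E\<^esub> y) \<otimes>\<^bsub>?E\<^esub> z = (x \<otimes>\<^bsub>?E\<^esub> z) \<oplus>\<^bsub>?E\<^esub> (y \<otimes>\<^bsub>?E\<^esub> z)"
      if "x \<in> carrier ?E" "y \<in> carrier ?E" "z \<in> carrier ?E"
      using that by (auto simp: matrices_carrier V.lincomb_add)
    show "z \<otimes>\<^bsub>?E\<^esub> (x \<oplus>\<^bsub>?E\<^esub> y) = (z \<otimes>\<^bsub>?E\<^esub> x) \<oplus>\<^bsub>?E\<^esub> (z \<otimes>\<^bsub>?E\<^esub> y)"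
      if "x \<in> carrier ?E" "y \<in> carrier ?E" "z \<in> carrier ?E"
      using that by (auto simp: matrices_carrier linear_map_add[OF V.lincomb_linear])
    show "(c \<odot>\<^bsub>?E\<^esub> x) \<otimes>\<^bsub>?E\<^esub> y = c \<odot>\<^bsub>?E\<^esub> (x \<otimes>\<^bsub>?E\<^esub> y)"
      if "c \<in> carrier K" "x \<in> carrier ?E" "y \<in> carrier ?E"
      using that by (auto simp: matrices_carrier V.lincomb_smult)
    show "x \<otimes>\<^bsub>?E\<^esub> (c \<odot>\<^bsub>?E\<^esub> y) = c \<odot>\<^bsub>?E\<^esub> (x \<otimes>\<^bsub>?E\<^esub> y)"
      if "c \<in> carrier K" "x \<in> carrier ?E" "y \<in> carrier ?E"
      using that by (auto simp: matrices_carrier linear_map_smult[OF V.lincomb_linear])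
  qed (use closed add smult in simp_all)
qed

lemma inj_pow2_odd: "inj (\<lambda>(n, j). 2 ^ n * Suc (2 * j))"
proof (rule injI, clarify)
  show "n = m \<and> j = i" if "2 ^ n * Suc (2 * j) = 2 ^ m * Suc (2 * i)" for n m i j :: nat
    using that
  proof (induction n arbitrary: m)
    case 0
    then show ?case by (cases m) (auto, presburger)
  next
    case (Suc n)
    show ?case
    proof (cases m)
      case 0
      with Suc.prems show ?thesis by simp presburger
    next
      case (Suc m')
      with Suc.prems Suc.IH[of m'] show ?thesis by simp
    qed
  qed
qed

text \<open>
  Take \<open>z e\<^sub>k = e\<^bsub>2k\<^esub>\<close> and \<open>y e\<^bsub>2k\<^esub> = e\<^bsub>2k+1\<^esub>\<close>, so that \<open>u = y z\<close> maps \<open>e\<^sub>k\<close> to \<open>e\<^bsub>2k+1\<^esub>\<close>. The columns of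
  \<open>y\<close> with odd index are still free, and can be chosen such that \<open>T\<^sub>n = y u z\<^sup>n u\<close> for all \<open>n\<close>.
\<close>

lemma (in cring) matrices_two_generators:
  fixes T :: "nat \<Rightarrow> nat \<Rightarrow> nat \<Rightarrow> 'a"
  assumes T: "\<And>n. T n \<in> carrier (matrices R ops)"
  obtains z y where "z \<in> carrier (matrices R ops)" "y \<in> carrier (matrices R ops)"
    and "\<And>S. \<lbrakk>z \<in> S; y \<in> S; \<And>f g. f \<in> S \<Longrightarrow> g \<in> S \<Longrightarrow> f \<otimes>\<^bsub>matrices R ops\<^esub> g \<in> S\<rbrakk> \<Longrightarrow> range T \<subseteq> S"
proof -
  let ?E = "matrices R ops"
  interpret V: module R "vectors R" by (rule vectors_module)
  note [simp del] = vectors_sel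
  define code :: "nat \<times> nat \<Rightarrow> nat" where "code = (\<lambda>(n, j). 2 ^ n * Suc (2 * j))"
  have code_inv: "inv_into UNIV code (2 ^ n * Suc (2 * j)) = (n, j)" for n j
    using inv_f_f[of code "(n, j)"] inj_pow2_odd by (simp add: code_def)
  define z where "z = (\<lambda>k. unit_vec R (2 * k))"
  define y where "y = (\<lambda>k. if even k then unit_vec R (Suc k) else case_prod T (inv_into UNIV code (k div 2)))"
  have z: "z \<in> carrier ?E" by (simp add: z_def matrices_carrier)
  have y: "y \<in> carrier ?E" using T by (auto simp: y_def matrices_carrier split: prod.split)
  have *: "T n \<in> S"
    if S: "z \<in> S" "y \<in> S" "\<And>f g. f \<in> S \<Longrightarrow> g \<in> S \<Longrightarrow> f \<otimes>\<^bsub>?E\<^esub> g \<in> S" for S n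
  proof -
    define u where "u = y \<otimes>\<^bsub>?E\<^esub> z"
    have u: "u k = unit_vec R (Suc (2 * k))" for k
      using y by (simp add: u_def z_def matrices_carrier) (simp add: y_def)
    have uS: "u \<in> S" unfolding u_def using S by blast
    have uE: "u \<in> carrier ?E" by (simp add: u matrices_carrier)
    have "(\<lambda>k. unit_vec R (2 ^ n * Suc (2 * k))) \<in> S" for n
    proof (induction n)
      case 0
      have "u = (\<lambda>k. unit_vec R (2 ^ 0 * Suc (2 * k)))" by (simp add: u fun_eq_iff)
      with uS show ?case by simp
    next
      case (Suc n)
      have "z \<otimes>\<^bsub>?E\<^esub> (\<lambda>k. unit_vec R (2 ^ n * Suc (2 * k))) = (\<lambda>k. unit_vec R (2 ^ Suc n * Suc (2 * k)))"
        using z by (simp add: matrices_carrier) (simp add: z_def)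
      with S(3)[OF S(1) Suc] show ?case by simp
    qed
    from S(3)[OF S(2) S(3)[OF uS this]]
    have "(\<lambda>k. y (Suc (2 * (2 ^ n * Suc (2 * k))))) \<in> S" for n
      using uE y by (simp add: matrices_carrier) (simp add: u)
    moreover have "(\<lambda>k. y (Suc (2 * (2 ^ n * Suc (2 * k))))) = T n" for n
      using code_inv by (simp add: y_def del: mult_Suc_right)
    ultimately show ?thesis by simp
  qed
  show thesis by (rule that[OF z y]) (use * in blast)
qed

lemma (in module) lincomb_single:
  assumes x: "x \<in> carrier M" and v: "v \<in> carrier (vectors R)"
  shows "lincomb R M (\<lambda>k. if k = j then x else \<zero>\<^bsub>M\<^esub>) v = v j \<odot>\<^bsub>M\<^esub> x"
proof -
  let ?S = "insert j {n. v n \<noteq> \<zero>}"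
  have fin: "finite ?S" using v by (simp add: vectors_carrier)
  have "lincomb R M (\<lambda>k. if k = j then x else \<zero>\<^bsub>M\<^esub>) v
      = (\<Oplus>\<^bsub>M\<^esub>k\<in>?S. v k \<odot>\<^bsub>M\<^esub> (if k = j then x else \<zero>\<^bsub>M\<^esub>))"
    using x by (intro lincomb_superset[OF _ v fin]) auto
  also have "\<dots> = (\<Oplus>\<^bsub>M\<^esub>k\<in>?S. if k = j then v k \<odot>\<^bsub>M\<^esub> x else \<zero>\<^bsub>M\<^esub>)"
    using x v by (intro M.finsum_cong') (auto simp: vectors_carrier)
  also have "\<dots> = v j \<odot>\<^bsub>M\<^esub> x"
    using x v fin by (intro M.add.finprod_singleton_swap) (auto simp: vectors_carrier)
  finally show ?thesis .
qed

lemma linear_map_comp: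
  "linear_map K M N g \<Longrightarrow> linear_map K N P h \<Longrightarrow> linear_map K M P (\<lambda>x. h (g x))"
  unfolding linear_map_def by metis

locale coordinatized = omega_algebra K Om ar A
  for K :: "('k, 'm) ring_scheme" (structure)
    and Om :: "'o set" and ar :: "'o \<Rightarrow> nat"
    and A :: "('k, 'a, 'o, 'n) omega_algebra_scheme" (structure) +
  fixes w :: "nat \<Rightarrow> 'a" and r :: "'a \<Rightarrow> nat \<Rightarrow> 'k"
  assumes w_closed [simp]: "w n \<in> carrier A"
    and r_linear: "linear_map K A (vectors K) r"
    and lincomb_r [simp]: "x \<in> carrier A \<Longrightarrow> lincomb K A w (r x) = x"
begin

declare vectors_sel [simp del]
declare mult_closed [simp]

sublocale V: module K "vectors K" by (rule vectors_module)

definition block :: "nat \<Rightarrow> (nat \<Rightarrow> 'k) \<Rightarrow> nat \<Rightarrow> 'k"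
  where "block i = lincomb K (vectors K) (\<lambda>k. unit_vec K (prod_encode (i, Suc k)))"

lemma block_linear: "linear_map K (vectors K) (vectors K) (block i)"
  unfolding block_def by (rule V.lincomb_linear) simp

lemma linear_map_block:
  assumes "module K M" "linear_map K (vectors K) M h" "v \<in> carrier (vectors K)"
  shows "h (block i v) = lincomb K M (\<lambda>k. h (unit_vec K (prod_encode (i, Suc k)))) v"
  unfolding block_def using assms by (intro V.linear_map_lincomb) auto

lemmas block_closed [simp] = linear_map_closed[OF block_linear]
lemmas r_closed [simp] = linear_map_closed[OF r_linear]

text \<open>Index \<open>0\<close> of each block stands for an adjoined unit, which keeps the representation faithful.\<close>

definition act :: "'a \<Rightarrow> nat \<Rightarrow> 'a"
  where "act a k = (case k of 0 \<Rightarrow> a | Suc k' \<Rightarrow> a \<otimes>\<^bsub>A\<^esub> w k')"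

lemma act_simps [simp]: "act a 0 = a" "act a (Suc k) = a \<otimes>\<^bsub>A\<^esub> w k"
  by (simp_all add: act_def)

lemma act_closed [simp]: "a \<in> carrier A \<Longrightarrow> act a k \<in> carrier A"
  by (cases k) auto

definition rep :: "'a \<Rightarrow> nat \<Rightarrow> nat \<Rightarrow> 'k"
  where "rep a m = (case prod_decode m of (i, k) \<Rightarrow> block i (r (act a k)))"

lemma rep_column: "rep a (prod_encode (i, k)) = block i (r (act a k))"
  by (simp add: rep_def)

lemma rep_linear: "linear_map K A (matrices K ops) rep"
proof -
  have "act (a \<oplus>\<^bsub>A\<^esub> b) k = act a k \<oplus>\<^bsub>A\<^esub> act b k" if "a \<in> carrier A" "b \<in> carrier A" for a b k
    using that by (cases k) (auto simp: mult_add_left)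
  moreover have "act (c \<odot>\<^bsub>A\<^esub> a) k = c \<odot>\<^bsub>A\<^esub> act a k" if "c \<in> carrier K" "a \<in> carrier A" for a c k
    using that by (cases k) (auto simp: mult_smult_left)
  ultimately show ?thesis
    unfolding linear_map_def
    by (auto simp: rep_def matrices_carrier fun_eq_iff linear_map_add[OF r_linear]
        linear_map_smult[OF r_linear] linear_map_add[OF block_linear]
        linear_map_smult[OF block_linear] split: prod.split)
qed

lemma rep_closed [simp]: "a \<in> carrier A \<Longrightarrow> rep a m \<in> carrier (vectors K)"
  using linear_map_closed[OF rep_linear] by (simp add: matrices_carrier)

lemma rep_mult:
  assumes a: "a \<in> carrier A" and b: "b \<in> carrier A"
  shows "rep (a \<otimes>\<^bsub>A\<^esub> b) = rep a \<otimes>\<^bsub>matrices K ops\<^esub> rep b"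
proof
  fix m
  obtain i k where m: "m = prod_encode (i, k)" by (metis prod_decode_inverse surj_pair)
  let ?v = "r (act b k)"
  have "linear_map K A A (\<lambda>x. a \<otimes>\<^bsub>A\<^esub> x)"
    using a by (auto simp: linear_map_def mult_add_right mult_smult_right)
  then have lin: "linear_map K A (vectors K) (\<lambda>x. block i (r (a \<otimes>\<^bsub>A\<^esub> x)))"
    by (rule linear_map_comp[OF linear_map_comp[OF _ r_linear] block_linear])
  have "(rep a \<otimes>\<^bsub>matrices K ops\<^esub> rep b) m = lincomb K (vectors K) (rep a) (block i ?v)"
    by (simp add: m rep_column)
  also have "\<dots> = lincomb K (vectors K) (\<lambda>k. rep a (prod_encode (i, Suc k))) ?v"
    using a b by (simp add: linear_map_block[OF V.module_axioms V.lincomb_linear])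
  also have "\<dots> = block i (r (a \<otimes>\<^bsub>A\<^esub> lincomb K A w ?v))"
    using b linear_map_lincomb[OF V.module_axioms lin, of w ?v] by (simp add: rep_column)
  also have "\<dots> = rep (a \<otimes>\<^bsub>A\<^esub> b) m"
    using a b by (cases k) (auto simp: m rep_column mult_assoc)
  finally show "rep (a \<otimes>\<^bsub>A\<^esub> b) m = (rep a \<otimes>\<^bsub>matrices K ops\<^esub> rep b) m" by simp
qed

lemma rep_divides_one:
  assumes a: "a \<in> carrier A" "a \<noteq> \<zero>\<^bsub>A\<^esub>"
  obtains b where "b \<in> carrier (matrices K ops)"
    and "b \<otimes>\<^bsub>matrices K ops\<^esub> (rep a \<otimes>\<^bsub>matrices K ops\<^esub> (\<lambda>i. unit_vec K (prod_encode (i, 0)))) = unit_vec K"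
proof -
  have "\<exists>j. r a j \<noteq> \<zero>"
  proof (rule ccontr)
    assume "\<nexists>j. r a j \<noteq> \<zero>"
    then have "lincomb K A w (r a) = \<zero>\<^bsub>A\<^esub>" by (simp add: lincomb_def)
    with a show False by simp
  qed
  then obtain j where j: "r a j \<noteq> \<zero>" by blast
  define c where "c = r a j"
  have c: "c \<in> carrier K" "inv c \<in> carrier K" "c \<otimes> inv c = \<one>"
    using a r_closed[of a] j field_Units
    by (auto simp: c_def vectors_carrier intro: Units_inv_closed Units_r_inv)
  define b where "b m = (case prod_decode m of (i, k) \<Rightarrow>
    if k = Suc j then inv c \<odot>\<^bsub>vectors K\<^esub> unit_vec K i else \<zero>\<^bsub>vectors K\<^esub>)" for m
  have b: "b m \<in> carrier (vectors K)" for m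
    using c by (auto simp: b_def split: prod.split)
  have "lincomb K (vectors K) b (block i (r a)) = unit_vec K i" for i
  proof -
    have "lincomb K (vectors K) b (block i (r a))
        = lincomb K (vectors K) (\<lambda>k. if k = j then inv c \<odot>\<^bsub>vectors K\<^esub> unit_vec K i else \<zero>\<^bsub>vectors K\<^esub>) (r a)"
      using a b by (simp add: linear_map_block[OF V.module_axioms V.lincomb_linear])
        (simp add: b_def)
    also have "\<dots> = c \<odot>\<^bsub>vectors K\<^esub> (inv c \<odot>\<^bsub>vectors K\<^esub> unit_vec K i)"
      unfolding c_def using a c by (intro V.lincomb_single) (auto simp: c_def)
    also have "\<dots> = unit_vec K i"
      using c by (simp add: V.smult_assoc1[symmetric])
    finally show ?thesis .
  qed
  then have "b \<otimes>\<^bsub>matrices K ops\<^esub> (rep a \<otimes>\<^bsub>matrices K ops\<^esub> (\<lambda>i. unit_vec K (prod_encode (i, 0)))) = unit_vec K"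
    using a by (simp add: rep_column)
  then show thesis using b by (intro that) (auto simp: matrices_carrier)
qed

definition coord :: "nat \<Rightarrow> 'a"
  where "coord m = (case prod_decode m of (i, k) \<Rightarrow>
    if i = 0 \<and> k \<noteq> 0 then w (k - 1) else \<zero>\<^bsub>A\<^esub>)"

lemma coord_closed [simp]: "coord m \<in> carrier A"
  by (auto simp: coord_def split: prod.split)

definition retract :: "(nat \<Rightarrow> nat \<Rightarrow> 'k) \<Rightarrow> 'a"
  where "retract f = lincomb K A coord (f (prod_encode (0, 0)))"

lemma retract_linear: "linear_map K (matrices K ops) A retract"
proof -
  have "linear_map K (matrices K ops) (vectors K) (\<lambda>f. f (prod_encode (0, 0)))"
    by (simp add: linear_map_def matrices_carrier)
  then have "linear_map K (matrices K ops) A (\<lambda>f. lincomb K A coord (f (prod_encode (0, 0))))"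
    by (rule linear_map_comp) (simp add: lincomb_linear)
  then show ?thesis by (simp add: retract_def linear_map_def)
qed

lemma retract_rep [simp]:
  assumes a: "a \<in> carrier A"
  shows "retract (rep a) = a"
proof -
  have "retract (rep a) = lincomb K A (\<lambda>k. coord (prod_encode (0, Suc k))) (r a)"
    using a by (simp add: retract_def rep_column linear_map_block[OF module_axioms lincomb_linear])
  then show ?thesis using a by (simp add: coord_def)
qed

definition envelope :: "('k, nat \<Rightarrow> nat \<Rightarrow> 'k, 'o) omega_algebra"
  where "envelope = matrices K (\<lambda>d fs. rep (interp A d (map retract fs)))"

lemma envelope_omega_algebra: "omega_algebra K Om ar envelope"
  unfolding envelope_def
proof (rule matrices_omega_algebra)
  let ?ops = "\<lambda>d fs. rep (interp A d (map retract fs))"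
  let ?E = "matrices K ?ops"
  note ret = linear_mapD[OF retract_linear[where ops = ?ops]]
  note rep = linear_mapD[OF rep_linear[where ops = ?ops]]
  have args: "map retract xs \<in> args A n" if "xs \<in> args ?E n" for xs n
    using that ret(1) by (auto simp: args_def)
  show "field K" ..
  fix d xs i x y c
  assume d: "d \<in> Om" and xs: "xs \<in> args ?E (ar d)"
  then show "?ops d xs \<in> carrier ?E" by (intro rep(1) interp_closed args)
  assume i: "i < ar d" and x: "x \<in> carrier ?E"
  have upd: "interp A d ((map retract xs)[i := retract x]) \<in> carrier A" if "x \<in> carrier ?E" for x
    using that args[OF xs] ret(1) set_update_subset_insert[of "map retract xs" i "retract x"]
    by (intro interp_closed[OF d]) (auto simp: args_def)
  show "?ops d (xs[i := x \<oplus>\<^bsub>?E\<^esub> y]) = ?ops d (xs[i := x]) \<oplus>\<^bsub>?E\<^esub> ?ops d (xs[i := y])"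
    if y: "y \<in> carrier ?E"
    using x y upd by (simp only: map_update ret interp_add[OF d args[OF xs] i] rep(2))
  show "?ops d (xs[i := c \<odot>\<^bsub>?E\<^esub> x]) = c \<odot>\<^bsub>?E\<^esub> ?ops d (xs[i := x])" if c: "c \<in> carrier K"
    using x c upd by (simp only: map_update ret interp_smult[OF d args[OF xs] i] rep(3))
qed

lemma rep_hom: "rep \<in> omega_hom K Om ar A envelope"
proof -
  let ?ops = "\<lambda>d fs. rep (interp A d (map retract fs))"
  have "rep (interp A d xs) = interp envelope d (map rep xs)" if "d \<in> Om" "xs \<in> args A (ar d)" for d xs
  proof -
    have "map retract (map rep xs) = xs"
      using that by (auto simp: args_def intro!: map_idI)
    then show ?thesis by (simp add: envelope_def)
  qed
  then show ?thesis
    using linear_mapD[OF rep_linear[where ops = ?ops]] rep_mult[where ops = ?ops]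
    unfolding omega_hom_def envelope_def by simp
qed

end

section \<open>Subalgebras, ideals and quotients\<close>

lemma omega_subalgebraD:
  assumes "omega_subalgebra K Om ar A S"
  shows omega_subalgebra_submodule: "submodule S K A"
    and omega_subalgebra_mult: "x \<in> S \<Longrightarrow> y \<in> S \<Longrightarrow> x \<otimes>\<^bsub>A\<^esub> y \<in> S"
    and omega_subalgebra_interp: "d \<in> Om \<Longrightarrow> xs \<in> args A (ar d) \<Longrightarrow> set xs \<subseteq> S \<Longrightarrow> interp A d xs \<in> S"
  using assms by (auto simp: omega_subalgebra_def)

lemma omega_idealD:
  assumes "omega_ideal K Om ar A I"
  shows omega_ideal_submodule: "submodule I K A"
    and omega_ideal_mult_left: "x \<in> I \<Longrightarrow> a \<in> carrier A \<Longrightarrow> a \<otimes>\<^bsub>A\<^esub> x \<in> I"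
    and omega_ideal_mult_right: "x \<in> I \<Longrightarrow> a \<in> carrier A \<Longrightarrow> x \<otimes>\<^bsub>A\<^esub> a \<in> I"
    and omega_ideal_interp: "d \<in> Om \<Longrightarrow> xs \<in> args A (ar d) \<Longrightarrow> i < ar d \<Longrightarrow> xs ! i \<in> I \<Longrightarrow> interp A d xs \<in> I"
  using assms unfolding omega_ideal_def by blast+

lemma omega_homD:
  assumes "h \<in> omega_hom K Om ar A B"
  shows omega_hom_linear: "linear_map K A B h"
    and omega_hom_mult: "x \<in> carrier A \<Longrightarrow> y \<in> carrier A \<Longrightarrow> h (x \<otimes>\<^bsub>A\<^esub> y) = h x \<otimes>\<^bsub>B\<^esub> h y"
    and omega_hom_interp: "d \<in> Om \<Longrightarrow> xs \<in> args A (ar d) \<Longrightarrow> h (interp A d xs) = interp B d (map h xs)"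
  using assms unfolding omega_hom_def linear_map_def by blast+

lemma omega_hom_comp:
  assumes f: "f \<in> omega_hom K Om ar A B" and g: "g \<in> omega_hom K Om ar B C"
  shows "g \<circ> f \<in> omega_hom K Om ar A C"
proof -
  have "map f xs \<in> args B n" if "xs \<in> args A n" for xs n
    using that linear_map_closed[OF omega_hom_linear[OF f]] by (auto simp: args_def)
  then show ?thesis
    using f g unfolding omega_hom_def by auto
qed

context omega_algebra
begin

lemma args_update: "xs \<in> args A n \<Longrightarrow> x \<in> carrier A \<Longrightarrow> xs[i := x] \<in> args A n"
  using set_update_subset_insert[of xs i x] by (auto simp: args_def)

lemma smult_uminus_one: "x \<in> carrier A \<Longrightarrow> (\<ominus> \<one>) \<odot>\<^bsub>A\<^esub> x = \<ominus>\<^bsub>A\<^esub> x"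
  by (simp add: smult_l_minus)

lemma omega_subalgebra_algebra:
  assumes S: "omega_subalgebra K Om ar A S"
  shows "omega_algebra K Om ar (A\<lparr>carrier := S\<rparr>)"
proof -
  note sub = omega_subalgebra_submodule[OF S]
  have sc: "x \<in> carrier A" if "x \<in> S" for x using submoduleE(1)[OF sub] that by blast
  have args: "xs \<in> args A n" "set xs \<subseteq> S" if "xs \<in> args (A\<lparr>carrier := S\<rparr>) n" for xs n
    using that sc by (auto simp: args_def)
  show ?thesis
  proof (intro omega_algebra.intro omega_algebra_axioms.intro)
    show "field K" ..
    show "module K (A\<lparr>carrier := S\<rparr>)"
      using sub by (rule submodule.submodule_is_module) (rule module_axioms)
    show "interp (A\<lparr>carrier := S\<rparr>) d xs \<in> carrier (A\<lparr>carrier := S\<rparr>)"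
      if "d \<in> Om" "xs \<in> args (A\<lparr>carrier := S\<rparr>) (ar d)" for d xs
      using omega_subalgebra_interp[OF S that(1) args[OF that(2)]] by simp
  qed (auto simp: sc mult_assoc mult_add_left mult_add_right mult_smult_left mult_smult_right
      args interp_add interp_smult intro: omega_subalgebra_mult[OF S])
qed

lemma omega_subalgebra_trans:
  assumes S: "omega_subalgebra K Om ar A S" and T: "omega_subalgebra K Om ar (A\<lparr>carrier := S\<rparr>) T"
  shows "omega_subalgebra K Om ar A T"
proof -
  interpret S: omega_algebra K Om ar "A\<lparr>carrier := S\<rparr>" using S by (rule omega_subalgebra_algebra)
  note subS = submoduleE(1)[OF omega_subalgebra_submodule[OF S]]
  note subT = omega_subalgebra_submodule[OF T]
  note TE = S.submoduleE[OF subT]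
  have TS: "T \<subseteq> S" using TE(1) by simp
  have "submodule T K A"
  proof (rule submoduleI)
    show "T \<subseteq> carrier A" using TS subS by blast
    show "\<zero>\<^bsub>A\<^esub> \<in> T" using S.submodule_zero[OF subT] by simp
    show "\<ominus>\<^bsub>A\<^esub> a \<in> T" if "a \<in> T" for a
      using TE(4)[of "\<ominus> \<one>" a] that TS subS by (auto simp: smult_uminus_one[symmetric])
    show "a \<oplus>\<^bsub>A\<^esub> b \<in> T" if "a \<in> T" "b \<in> T" for a b using TE(5) that by simp
    show "c \<odot>\<^bsub>A\<^esub> a \<in> T" if "c \<in> carrier K" "a \<in> T" for a c using TE(4) that by simp
  qed
  moreover have "x \<otimes>\<^bsub>A\<^esub> y \<in> T" if "x \<in> T" "y \<in> T" for x y
    using omega_subalgebra_mult[OF T] that by simp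
  moreover have "interp A d xs \<in> T" if "d \<in> Om" "xs \<in> args A (ar d)" "set xs \<subseteq> T" for d xs
    using omega_subalgebra_interp[OF T, of d xs] that TS by (auto simp: args_def)
  ultimately show ?thesis unfolding omega_subalgebra_def by blast
qed

lemma countable_omega_span:
  assumes "countable (carrier K)" "countable Om" "countable Y" and Y: "Y \<subseteq> carrier A"
  shows "countable (omega_span K Om ar A Y)"
proof -
  define F where "F S = S \<union> {\<zero>\<^bsub>A\<^esub>} \<union> (\<lambda>(x, y). x \<oplus>\<^bsub>A\<^esub> y) ` (S \<times> S)
    \<union> (\<lambda>(c, x). c \<odot>\<^bsub>A\<^esub> x) ` (carrier K \<times> S) \<union> (\<lambda>(x, y). x \<otimes>\<^bsub>A\<^esub> y) ` (S \<times> S)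
    \<union> (\<lambda>(d, xs). interp A d xs) ` (SIGMA d:Om. {xs \<in> lists S. xs \<in> args A (ar d)})" for S
  define C where "C n = (F ^^ n) Y" for n
  have C0: "C 0 = Y" and CSuc: "C (Suc n) = F (C n)" for n by (simp_all add: C_def)
  have count: "countable (C n)" for n
  proof (induction n)
    case 0 with assms(3) show ?case by (simp add: C0)
  next
    case (Suc n)
    with assms(1,2) show ?case
      unfolding CSuc F_def by (intro countable_Un countable_image countable_SIGMA countable_Collect) auto
  qed
  have carr: "C n \<subseteq> carrier A" for n
  proof (induction n)
    case 0 with Y show ?case by (simp add: C0)
  next
    case (Suc n)
    then show ?case unfolding CSuc F_def by (auto intro!: mult_closed interp_closed)
  qed
  have mono: "C m \<subseteq> C n" if "m \<le> n" for m n
    using that by (induction n rule: dec_induct) (auto simp: CSuc F_def)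
  have lift: "\<exists>n. set xs \<subseteq> C n" if "set xs \<subseteq> (\<Union>n. C n)" for xs
    using that
  proof (induction xs)
    case (Cons x xs)
    then obtain m n where "x \<in> C m" "set xs \<subseteq> C n" by auto
    with mono[of m "max m n"] mono[of n "max m n"] show ?case
      by (intro exI[of _ "max m n"]) auto
  qed simp
  have pair: "\<exists>n. x \<in> C n \<and> y \<in> C n" if "x \<in> (\<Union>n. C n)" "y \<in> (\<Union>n. C n)" for x y
    using lift[of "[x, y]"] that by simp
  have "omega_subalgebra K Om ar A (\<Union>n. C n)"
    unfolding omega_subalgebra_def
  proof (intro conjI ballI impI)
    have smult: "c \<odot>\<^bsub>A\<^esub> x \<in> (\<Union>n. C n)" if c: "c \<in> carrier K" and "x \<in> (\<Union>n. C n)" for c x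
    proof -
      from that obtain n where "x \<in> C n" by blast
      with c have "c \<odot>\<^bsub>A\<^esub> x \<in> C (Suc n)" unfolding CSuc F_def by blast
      then show ?thesis by blast
    qed
    show "submodule (\<Union>n. C n) K A"
    proof (rule submoduleI)
      show "(\<Union>n. C n) \<subseteq> carrier A" using carr by blast
      have "\<zero>\<^bsub>A\<^esub> \<in> C (Suc 0)" unfolding CSuc F_def by blast
      then show "\<zero>\<^bsub>A\<^esub> \<in> (\<Union>n. C n)" by blast
      show "\<ominus>\<^bsub>A\<^esub> x \<in> (\<Union>n. C n)" if "x \<in> (\<Union>n. C n)" for x
      proof -
        have "x \<in> carrier A" using that carr by blast
        with smult[of "\<ominus> \<one>" x] that show ?thesis by (simp add: smult_uminus_one)
      qed
      show "x \<oplus>\<^bsub>A\<^esub> y \<in> (\<Union>n. C n)" if xy: "x \<in> (\<Union>n. C n)" "y \<in> (\<Union>n. C n)" for x y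
      proof -
        from pair[OF xy] obtain n where "x \<in> C n" "y \<in> C n" by blast
        then have "x \<oplus>\<^bsub>A\<^esub> y \<in> C (Suc n)" unfolding CSuc F_def by blast
        then show ?thesis by blast
      qed
    qed (rule smult)
    show "x \<otimes>\<^bsub>A\<^esub> y \<in> (\<Union>n. C n)" if xy: "x \<in> (\<Union>n. C n)" "y \<in> (\<Union>n. C n)" for x y
    proof -
      from pair[OF xy] obtain n where "x \<in> C n" "y \<in> C n" by blast
      then have "x \<otimes>\<^bsub>A\<^esub> y \<in> C (Suc n)" unfolding CSuc F_def by blast
      then show ?thesis by blast
    qed
    show "interp A d xs \<in> (\<Union>n. C n)"
      if d: "d \<in> Om" and xs: "xs \<in> args A (ar d)" "set xs \<subseteq> (\<Union>n. C n)" for d xs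
    proof -
      from lift[OF xs(2)] obtain n where "set xs \<subseteq> C n" by blast
      with d xs(1) have "interp A d xs \<in> C (Suc n)" unfolding CSuc F_def by blast
      then show ?thesis by blast
    qed
  qed
  moreover have "Y \<subseteq> (\<Union>n. C n)" using C0 by blast
  ultimately have "omega_span K Om ar A Y \<subseteq> (\<Union>n. C n)"
    unfolding omega_span_def by blast
  then show ?thesis by (rule countable_subset) (simp add: count)
qed

lemma interp_minus:
  assumes d: "d \<in> Om" and xs: "xs \<in> args A (ar d)" and i: "i < ar d"
    and x: "x \<in> carrier A" and y: "y \<in> carrier A"
  shows "interp A d (xs[i := x \<ominus>\<^bsub>A\<^esub> y]) = interp A d (xs[i := x]) \<ominus>\<^bsub>A\<^esub> interp A d (xs[i := y])"
proof -
  have closed: "interp A d (xs[i := z]) \<in> carrier A" if "z \<in> carrier A" for z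
    using that by (intro interp_closed[OF d] args_update[OF xs])
  have "interp A d (xs[i := x \<ominus>\<^bsub>A\<^esub> y])
      = interp A d (xs[i := x]) \<oplus>\<^bsub>A\<^esub> interp A d (xs[i := (\<ominus> \<one>) \<odot>\<^bsub>A\<^esub> y])"
    using x y interp_add[OF d xs i, of x "\<ominus>\<^bsub>A\<^esub> y"] by (simp add: a_minus_def smult_uminus_one)
  also have "\<dots> = interp A d (xs[i := x]) \<ominus>\<^bsub>A\<^esub> interp A d (xs[i := y])"
    using x y closed by (subst interp_smult[OF d xs i]) (auto simp: a_minus_def smult_uminus_one)
  finally show ?thesis .
qed

lemma omega_ideal_interp_cong:
  assumes I: "omega_ideal K Om ar A I" and d: "d \<in> Om"
    and xs: "xs \<in> args A (ar d)" and ys: "ys \<in> args A (ar d)"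
    and rel: "\<And>i. i < ar d \<Longrightarrow> xs ! i \<ominus>\<^bsub>A\<^esub> ys ! i \<in> I"
  shows "interp A d xs \<ominus>\<^bsub>A\<^esub> interp A d ys \<in> I"
proof -
  note sub = omega_ideal_submodule[OF I]
  define zs where "zs k = take k xs @ drop k ys" for k
  have zs: "zs k \<in> args A (ar d)" for k
    using xs ys by (auto simp: zs_def args_def dest!: in_set_takeD in_set_dropD)
  have "k \<le> ar d \<Longrightarrow> interp A d (zs k) \<ominus>\<^bsub>A\<^esub> interp A d ys \<in> I" for k
  proof (induction k)
    case 0
    have "interp A d ys \<in> carrier A" using d ys by (rule interp_closed)
    then show ?case using submodule_zero[OF sub] by (simp add: zs_def a_minus_def M.r_neg)
  next
    case (Suc k)
    then have k: "k < ar d" by simp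
    have len: "length xs = ar d" "length ys = ar d" using xs ys by (auto simp: args_def)
    have c: "xs ! k \<in> carrier A" "ys ! k \<in> carrier A"
      using xs ys k by (auto simp: args_def dest: nth_mem)
    have upd: "zs (Suc k) = (zs k)[k := xs ! k]" "zs k = (zs k)[k := ys ! k]"
      using k len by (auto simp: zs_def list_eq_iff_nth_eq nth_append nth_list_update min_def less_Suc_eq)
    have "interp A d ((zs k)[k := xs ! k \<ominus>\<^bsub>A\<^esub> ys ! k]) \<in> I"
      using k rel[OF k] c len zs[of k]
      by (intro omega_ideal_interp[OF I d args_update k]) (auto simp: args_def zs_def)
    then have "interp A d (zs (Suc k)) \<ominus>\<^bsub>A\<^esub> interp A d (zs k) \<in> I"
      using interp_minus[OF d zs k c] upd by metis
    from submoduleE(5)[OF sub this Suc.IH] k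
    have "interp A d (zs (Suc k)) \<ominus>\<^bsub>A\<^esub> interp A d (zs k) \<oplus>\<^bsub>A\<^esub> (interp A d (zs k) \<ominus>\<^bsub>A\<^esub> interp A d ys) \<in> I"
      by simp
    moreover have "interp A d (zs (Suc k)) \<in> carrier A" "interp A d (zs k) \<in> carrier A" "interp A d ys \<in> carrier A"
      using interp_closed[OF d] zs ys by auto
    ultimately show ?case by (simp add: minus_add_cancel)
  qed
  from this[of "ar d"] show ?thesis using xs ys by (simp add: zs_def args_def)
qed

lemma omega_ideal_zero: "omega_ideal K Om ar A {\<zero>\<^bsub>A\<^esub>}"
proof -
  have "submodule {\<zero>\<^bsub>A\<^esub>} K A" by (rule submoduleI) auto
  moreover have "a \<otimes>\<^bsub>A\<^esub> \<zero>\<^bsub>A\<^esub> = \<zero>\<^bsub>A\<^esub>" "\<zero>\<^bsub>A\<^esub> \<otimes>\<^bsub>A\<^esub> a = \<zero>\<^bsub>A\<^esub>" if "a \<in> carrier A" for a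
    using that mult_smult_right[of \<zero> a a] mult_smult_left[of \<zero> a a] mult_closed[of a a] by auto
  moreover have "interp A d xs = \<zero>\<^bsub>A\<^esub>"
    if d: "d \<in> Om" and xs: "xs \<in> args A (ar d)" and i: "i < ar d" "xs ! i = \<zero>\<^bsub>A\<^esub>" for d xs i
  proof -
    have "interp A d (xs[i := \<zero> \<odot>\<^bsub>A\<^esub> \<zero>\<^bsub>A\<^esub>]) = \<zero> \<odot>\<^bsub>A\<^esub> interp A d (xs[i := \<zero>\<^bsub>A\<^esub>])"
      by (intro interp_smult[OF d xs i(1)]) auto
    moreover have "xs[i := \<zero>\<^bsub>A\<^esub>] = xs" using i(2) by (metis list_update_id)
    ultimately show ?thesis using interp_closed[OF d xs] by simp
  qed
  ultimately show ?thesis unfolding omega_ideal_def by auto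
qed

lemma omega_ideal_Union_chain:
  assumes ne: "\<C> \<noteq> {}" and chain: "subset.chain \<A> \<C>"
    and ideal: "\<And>I. I \<in> \<C> \<Longrightarrow> omega_ideal K Om ar A I"
  shows "omega_ideal K Om ar A (\<Union>\<C>)"
proof -
  have "submodule (\<Union>\<C>) K A"
    by (rule submodule_Union_chain[OF ne chain omega_ideal_submodule[OF ideal]])
  with ideal show ?thesis unfolding omega_ideal_def by blast
qed

lemma ex_maximal_omega_ideal:
  assumes e: "e \<in> carrier A" "e \<noteq> \<zero>\<^bsub>A\<^esub>" and unit: "\<And>x. x \<in> carrier A \<Longrightarrow> x \<otimes>\<^bsub>A\<^esub> e = x"
  obtains M where "omega_ideal K Om ar A M" "e \<notin> M"
    and "\<And>I. omega_ideal K Om ar A I \<Longrightarrow> M \<subseteq> I \<Longrightarrow> I = M \<or> I = carrier A"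
proof -
  define \<A> where "\<A> = {I. omega_ideal K Om ar A I \<and> e \<notin> I}"
  have "\<A> \<noteq> {}" using omega_ideal_zero e(2) unfolding \<A>_def by blast
  moreover have "\<Union>\<C> \<in> \<A>" if "\<C> \<noteq> {}" "subset.chain \<A> \<C>" for \<C>
  proof -
    have "\<C> \<subseteq> \<A>" using that(2) by (auto simp: subset_chain_def)
    then have "omega_ideal K Om ar A (\<Union>\<C>)"
      by (intro omega_ideal_Union_chain[OF that]) (auto simp: \<A>_def)
    with \<open>\<C> \<subseteq> \<A>\<close> show ?thesis unfolding \<A>_def by blast
  qed
  ultimately obtain M where "M \<in> \<A>" and max: "\<And>X. X \<in> \<A> \<Longrightarrow> M \<subseteq> X \<Longrightarrow> X = M"
    using subset_Zorn_nonempty[of \<A>] by metis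
  then have M: "omega_ideal K Om ar A M" "e \<notin> M" by (auto simp: \<A>_def)
  have "I = M \<or> I = carrier A" if I: "omega_ideal K Om ar A I" "M \<subseteq> I" for I
  proof (cases "e \<in> I")
    case True
    have "x \<in> I" if "x \<in> carrier A" for x
      using omega_ideal_mult_left[OF I(1) True that] unit[OF that] by simp
    with submoduleE(1)[OF omega_ideal_submodule[OF I(1)]] show ?thesis by blast
  next
    case False
    with I max show ?thesis unfolding \<A>_def by blast
  qed
  with M show thesis by (rule that)
qed

lemma omega_quotient_cong:
  assumes I: "omega_ideal K Om ar A I"
  shows "\<lbrakk>x \<in> carrier A; x' \<in> carrier A; y \<in> carrier A; y' \<in> carrier A; x \<ominus>\<^bsub>A\<^esub> x' \<in> I; y \<ominus>\<^bsub>A\<^esub> y' \<in> I\<rbrakk>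
      \<Longrightarrow> (x \<oplus>\<^bsub>A\<^esub> y) \<ominus>\<^bsub>A\<^esub> (x' \<oplus>\<^bsub>A\<^esub> y') \<in> I"
    and "\<lbrakk>x \<in> carrier A; x' \<in> carrier A; y \<in> carrier A; y' \<in> carrier A; x \<ominus>\<^bsub>A\<^esub> x' \<in> I; y \<ominus>\<^bsub>A\<^esub> y' \<in> I\<rbrakk>
      \<Longrightarrow> x \<otimes>\<^bsub>A\<^esub> y \<ominus>\<^bsub>A\<^esub> x' \<otimes>\<^bsub>A\<^esub> y' \<in> I"
    and "\<lbrakk>c \<in> carrier K; x \<in> carrier A; x' \<in> carrier A; x \<ominus>\<^bsub>A\<^esub> x' \<in> I\<rbrakk>
      \<Longrightarrow> c \<odot>\<^bsub>A\<^esub> x \<ominus>\<^bsub>A\<^esub> c \<odot>\<^bsub>A\<^esub> x' \<in> I"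
proof -
  note IE = submoduleE[OF omega_ideal_submodule[OF I]]
  show "c \<odot>\<^bsub>A\<^esub> x \<ominus>\<^bsub>A\<^esub> c \<odot>\<^bsub>A\<^esub> x' \<in> I"
    if "c \<in> carrier K" "x \<in> carrier A" "x' \<in> carrier A" "x \<ominus>\<^bsub>A\<^esub> x' \<in> I"
    using that IE(4)[OF that(1,4)] by (simp add: a_minus_def smult_r_distr smult_r_minus)
  assume xy: "x \<in> carrier A" "x' \<in> carrier A" "y \<in> carrier A" "y' \<in> carrier A"
    and rel: "x \<ominus>\<^bsub>A\<^esub> x' \<in> I" "y \<ominus>\<^bsub>A\<^esub> y' \<in> I"
  have "(x \<oplus>\<^bsub>A\<^esub> y) \<ominus>\<^bsub>A\<^esub> (x' \<oplus>\<^bsub>A\<^esub> y') = (x \<ominus>\<^bsub>A\<^esub> x') \<oplus>\<^bsub>A\<^esub> (y \<ominus>\<^bsub>A\<^esub> y')"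
    using xy by (simp add: a_minus_def M.a_ac M.minus_add)
  with IE(5)[OF rel] show "(x \<oplus>\<^bsub>A\<^esub> y) \<ominus>\<^bsub>A\<^esub> (x' \<oplus>\<^bsub>A\<^esub> y') \<in> I" by simp
  have "linear_map K A A (\<lambda>x. x \<otimes>\<^bsub>A\<^esub> y)" "linear_map K A A (\<lambda>y. x' \<otimes>\<^bsub>A\<^esub> y)"
    using xy by (auto simp: linear_map_def mult_closed mult_add_left mult_add_right
        mult_smult_left mult_smult_right)
  note lin = this[THEN linear_map_minus[OF module_axioms module_axioms]]
  have "(x \<ominus>\<^bsub>A\<^esub> x') \<otimes>\<^bsub>A\<^esub> y \<oplus>\<^bsub>A\<^esub> x' \<otimes>\<^bsub>A\<^esub> (y \<ominus>\<^bsub>A\<^esub> y') \<in> I"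
    using xy rel by (intro IE(5) omega_ideal_mult_left[OF I] omega_ideal_mult_right[OF I])
  then show "x \<otimes>\<^bsub>A\<^esub> y \<ominus>\<^bsub>A\<^esub> x' \<otimes>\<^bsub>A\<^esub> y' \<in> I"
    using xy by (simp add: lin mult_closed M.minus_add_cancel)
qed

text \<open>The quotient by \<open>M\<close>, with each coset coded by the least index of its elements in an enumeration.\<close>

lemma countable_omega_quotient:
  fixes M :: "'a set"
  assumes count: "countable (carrier A)" and I: "omega_ideal K Om ar A M"
  obtains B :: "('k, nat, 'o) omega_algebra" and h
  where "omega_algebra K Om ar B" "h \<in> omega_hom K Om ar A B" "h ` carrier A = carrier B"
    and "\<And>x y. x \<in> carrier A \<Longrightarrow> y \<in> carrier A \<Longrightarrow> h x = h y \<longleftrightarrow> x \<ominus>\<^bsub>A\<^esub> y \<in> M"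
proof -
  note IE = submoduleE[OF omega_ideal_submodule[OF I]]
  define e where "e = from_nat_into (carrier A)"
  have ne: "carrier A \<noteq> {}" using M.zero_closed by blast
  have e: "range e = carrier A" unfolding e_def using ne count by (rule range_from_nat_into)
  have ec: "e n \<in> carrier A" for n using e by blast
  have sym: "y \<ominus>\<^bsub>A\<^esub> x \<in> M" if "x \<in> carrier A" "y \<in> carrier A" "x \<ominus>\<^bsub>A\<^esub> y \<in> M" for x y
    using IE(3)[OF that(3)] that(1,2) by (simp add: a_minus_def M.minus_add M.a_comm)
  have trans: "x \<ominus>\<^bsub>A\<^esub> z \<in> M"
    if "x \<in> carrier A" "y \<in> carrier A" "z \<in> carrier A" "x \<ominus>\<^bsub>A\<^esub> y \<in> M" "y \<ominus>\<^bsub>A\<^esub> z \<in> M" for x y z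
    using IE(5)[OF that(4,5)] that(1-3) by (simp add: M.minus_add_cancel)
  define h where "h x = (LEAST n. e n \<ominus>\<^bsub>A\<^esub> x \<in> M)" for x
  have eh: "e (h x) \<ominus>\<^bsub>A\<^esub> x \<in> M" if x: "x \<in> carrier A" for x
  proof -
    from x e obtain n where "x = e n" by blast
    with x have "e n \<ominus>\<^bsub>A\<^esub> x \<in> M"
      using submodule_zero[OF omega_ideal_submodule[OF I]] by (simp add: a_minus_def M.r_neg)
    then show ?thesis unfolding h_def by (rule LeastI)
  qed
  have h_eq: "h x = h y \<longleftrightarrow> x \<ominus>\<^bsub>A\<^esub> y \<in> M" if x: "x \<in> carrier A" and y: "y \<in> carrier A" for x y
  proof
    assume "h x = h y"
    then show "x \<ominus>\<^bsub>A\<^esub> y \<in> M"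
      using trans[OF x ec y] sym[OF ec x eh[OF x]] eh[OF y] by metis
  next
    assume rel: "x \<ominus>\<^bsub>A\<^esub> y \<in> M"
    have "e n \<ominus>\<^bsub>A\<^esub> x \<in> M \<longleftrightarrow> e n \<ominus>\<^bsub>A\<^esub> y \<in> M" for n
      using trans[OF ec x y _ rel] trans[OF ec y x _ sym[OF x y rel]] by blast
    then show "h x = h y" by (simp add: h_def)
  qed
  define B :: "('k, nat, 'o) omega_algebra" where
    "B = \<lparr>carrier = h ` carrier A, mult = (\<lambda>m n. h (e m \<otimes>\<^bsub>A\<^esub> e n)), one = h \<one>\<^bsub>A\<^esub>, zero = h \<zero>\<^bsub>A\<^esub>,
      add = (\<lambda>m n. h (e m \<oplus>\<^bsub>A\<^esub> e n)), smult = (\<lambda>c n. h (c \<odot>\<^bsub>A\<^esub> e n)),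
      interp = (\<lambda>d ns. h (interp A d (map e ns)))\<rparr>"
  have carrier: "carrier B = h ` carrier A" and zero: "\<zero>\<^bsub>B\<^esub> = h \<zero>\<^bsub>A\<^esub>" by (simp_all add: B_def)
  have hom: "h x \<oplus>\<^bsub>B\<^esub> h y = h (x \<oplus>\<^bsub>A\<^esub> y)" "h x \<otimes>\<^bsub>B\<^esub> h y = h (x \<otimes>\<^bsub>A\<^esub> y)"
    if "x \<in> carrier A" "y \<in> carrier A" for x y
    using that by (simp_all add: B_def h_eq ec eh mult_closed omega_quotient_cong[OF I])
  have hom_smult: "c \<odot>\<^bsub>B\<^esub> h x = h (c \<odot>\<^bsub>A\<^esub> x)" if "x \<in> carrier A" "c \<in> carrier K" for x c
    using that by (simp add: B_def h_eq ec eh omega_quotient_cong(3)[OF I])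
  have args: "map e (map h xs) \<in> args A n" if "xs \<in> args A n" for xs n
    using that ec by (auto simp: args_def)
  have hom_interp: "interp B d (map h xs) = h (interp A d xs)" if "d \<in> Om" "xs \<in> args A (ar d)" for d xs
  proof -
    have "interp A d (map e (map h xs)) \<ominus>\<^bsub>A\<^esub> interp A d xs \<in> M"
      using that by (intro omega_ideal_interp_cong[OF I] args) (auto simp: args_def subset_iff eh)
    then show ?thesis
      using that interp_closed args by (simp add: B_def h_eq del: map_map)
  qed
  have B_args: "\<exists>ys. ys \<in> args A n \<and> xs = map h ys" if "xs \<in> args B n" for xs n
  proof (intro exI conjI)
    let ?g = "inv_into (carrier A) h"
    have xs: "set xs \<subseteq> h ` carrier A" "length xs = n" using that by (simp_all add: args_def carrier)
    then show "map ?g xs \<in> args A n" by (auto simp: args_def intro: inv_into_into)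
    show "xs = map h (map ?g xs)"
      using xs(1) by (auto simp: subset_iff f_inv_into_f intro!: map_idI[symmetric])
  qed
  have alg: "omega_algebra K Om ar B"
  proof (intro omega_algebra.intro omega_algebra_axioms.intro module.intro module_axioms.intro abelian_groupI)
    show "field K" "cring K" by unfold_locales
    show "\<exists>y\<in>carrier B. y \<oplus>\<^bsub>B\<^esub> x = \<zero>\<^bsub>B\<^esub>" if "x \<in> carrier B" for x
    proof -
      from that obtain a where a: "x = h a" "a \<in> carrier A" unfolding carrier by blast
      then have "h (\<ominus>\<^bsub>A\<^esub> a) \<oplus>\<^bsub>B\<^esub> x = \<zero>\<^bsub>B\<^esub>" by (simp add: hom zero M.l_neg)
      with a show ?thesis unfolding carrier by blast
    qed
    fix d xs i
    assume d: "d \<in> Om" and "xs \<in> args B (ar d)"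
    then obtain ys where ys: "ys \<in> args A (ar d)" and xs: "xs = map h ys" using B_args by blast
    show "interp B d xs \<in> carrier B"
      using interp_closed[OF d ys] by (simp add: xs hom_interp[OF d ys] carrier)
    assume i: "i < ar d"
    have upd: "interp B d (xs[i := h a]) = h (interp A d (ys[i := a]))" if "a \<in> carrier A" for a
      using hom_interp[OF d args_update[OF ys that]] by (simp add: xs map_update)
    have closed: "interp A d (ys[i := a]) \<in> carrier A" if "a \<in> carrier A" for a
      using interp_closed[OF d args_update[OF ys that]] .
    fix x
    assume "x \<in> carrier B"
    then obtain a where a: "x = h a" "a \<in> carrier A" unfolding carrier by blast
    show "interp B d (xs[i := x \<oplus>\<^bsub>B\<^esub> y]) = interp B d (xs[i := x]) \<oplus>\<^bsub>B\<^esub> interp B d (xs[i := y])"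
      if "y \<in> carrier B" for y
    proof -
      from that obtain b where "y = h b" "b \<in> carrier A" unfolding carrier by blast
      with a show ?thesis by (simp add: hom upd closed interp_add[OF d ys i])
    qed
    show "interp B d (xs[i := c \<odot>\<^bsub>B\<^esub> x]) = c \<odot>\<^bsub>B\<^esub> interp B d (xs[i := x])" if "c \<in> carrier K" for c
      using a that by (simp add: hom_smult upd closed interp_smult[OF d ys i])
  qed (auto simp: carrier zero hom hom_smult M.a_ac smult_l_distr smult_r_distr smult_assoc1 mult_closed
      mult_assoc mult_add_left mult_add_right mult_smult_left mult_smult_right)
  have "h \<in> omega_hom K Om ar A B"
    by (simp add: omega_hom_def hom hom_smult hom_interp carrier)
  from alg this carrier[symmetric] h_eq show thesis by (rule that)
qed

end

lemma omega_ideal_vimage: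
  assumes A: "omega_algebra K Om ar A" and B: "omega_algebra K Om ar B"
    and h: "h \<in> omega_hom K Om ar A B" and J: "omega_ideal K Om ar B J"
  shows "omega_ideal K Om ar A {x \<in> carrier A. h x \<in> J}"
proof -
  interpret A: omega_algebra K Om ar A by fact
  interpret B: omega_algebra K Om ar B by fact
  note JE = B.submoduleE[OF omega_ideal_submodule[OF J]]
  note lin = omega_hom_linear[OF h]
  have "submodule {x \<in> carrier A. h x \<in> J} K A"
  proof (rule A.submoduleI)
    show "\<zero>\<^bsub>A\<^esub> \<in> {x \<in> carrier A. h x \<in> J}"
      using B.submodule_zero[OF omega_ideal_submodule[OF J]]
      by (simp add: linear_map_zero[OF A.module_axioms B.module_axioms lin])
  qed (auto simp: linear_map_uminus[OF A.module_axioms B.module_axioms lin]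
      linear_map_add[OF lin] linear_map_smult[OF lin] JE(3-5))
  moreover have "interp A d xs \<in> {x \<in> carrier A. h x \<in> J}"
    if d: "d \<in> Om" and xs: "xs \<in> args A (ar d)" and i: "i < ar d" "xs ! i \<in> {x \<in> carrier A. h x \<in> J}"
    for d xs i
  proof -
    have "map h xs \<in> args B (ar d)" using xs linear_map_closed[OF lin] by (auto simp: args_def)
    then have "interp B d (map h xs) \<in> J"
      using i xs by (intro omega_ideal_interp[OF J d]) (auto simp: args_def)
    then show ?thesis using d xs A.interp_closed omega_hom_interp[OF h d xs] by simp
  qed
  ultimately show ?thesis
    unfolding omega_ideal_def
    by (auto simp: A.mult_closed omega_hom_mult[OF h] linear_map_closed[OF lin]
        intro: omega_ideal_mult_left[OF J] omega_ideal_mult_right[OF J])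
qed

lemma omega_subalgebra_vimage:
  assumes A: "omega_algebra K Om ar A" and B: "omega_algebra K Om ar B"
    and h: "h \<in> omega_hom K Om ar A B" and S: "omega_subalgebra K Om ar B S"
  shows "omega_subalgebra K Om ar A {x \<in> carrier A. h x \<in> S}"
proof -
  interpret A: omega_algebra K Om ar A by fact
  interpret B: omega_algebra K Om ar B by fact
  note SE = B.submoduleE[OF omega_subalgebra_submodule[OF S]]
  note lin = omega_hom_linear[OF h]
  have "submodule {x \<in> carrier A. h x \<in> S} K A"
  proof (rule A.submoduleI)
    show "\<zero>\<^bsub>A\<^esub> \<in> {x \<in> carrier A. h x \<in> S}"
      using B.submodule_zero[OF omega_subalgebra_submodule[OF S]]
      by (simp add: linear_map_zero[OF A.module_axioms B.module_axioms lin])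
  qed (auto simp: linear_map_uminus[OF A.module_axioms B.module_axioms lin]
      linear_map_add[OF lin] linear_map_smult[OF lin] SE(3-5))
  moreover have "interp A d xs \<in> {x \<in> carrier A. h x \<in> S}"
    if d: "d \<in> Om" and xs: "xs \<in> args A (ar d)" "set xs \<subseteq> {x \<in> carrier A. h x \<in> S}" for d xs
  proof -
    have "map h xs \<in> args B (ar d)" using xs linear_map_closed[OF lin] by (auto simp: args_def)
    then have "interp B d (map h xs) \<in> S"
      using xs by (intro omega_subalgebra_interp[OF S d]) auto
    then show ?thesis using d xs A.interp_closed omega_hom_interp[OF h d] by simp
  qed
  ultimately show ?thesis
    unfolding omega_subalgebra_def
    by (auto simp: A.mult_closed omega_hom_mult[OF h] intro: omega_subalgebra_mult[OF S])
qed

theorem theorem6p3: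
  fixes K :: "('k, 'm) ring_scheme"
    and Om :: "'o set" and ar :: "'o \<Rightarrow> nat"
    and A :: "('k, 'a, 'o) omega_algebra"
  assumes "field K" and "countable (carrier K)"
    and "countable Om" and "\<forall>d\<in>Om. 1 \<le> ar d"
    and "omega_algebra K Om ar A" and "countably_generated K Om ar A"
  shows "\<exists>(B :: ('k, nat, 'o) omega_algebra) x y h.
    omega_algebra K Om ar B \<and> omega_simple K Om ar B \<and>
    omega_generates K Om ar B {x, y} \<and>
    h \<in> omega_hom K Om ar A B \<and> inj_on h (carrier A)"
proof -
  interpret A: omega_algebra K Om ar A by fact
  have countA: "countable (carrier A)"
    using assms(6) A.countable_omega_span[OF assms(2,3)]
    unfolding countably_generated_def omega_generates_def by metis
  have neA: "carrier A \<noteq> {}" using A.M.zero_closed by blast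
  define w where "w = from_nat_into (carrier A)"
  have w: "range w = carrier A" unfolding w_def using neA countA by (rule range_from_nat_into)
  obtain r where "linear_map K A (vectors K) r" "\<And>x. x \<in> carrier A \<Longrightarrow> lincomb K A w (r x) = x"
    using linear_section[OF assms(1) A.module_axioms, of w] w by blast
  then interpret coordinatized K Om ar A w r
    using w by unfold_locales auto
  interpret E: omega_algebra K Om ar envelope by (rule envelope_omega_algebra)
  let ?E = envelope and ?V = "vectors K" and ?id = "unit_vec K"
  note [simp del] = vectors_sel
  have E_carrier: "f \<in> carrier ?E \<longleftrightarrow> (\<forall>n. f n \<in> carrier ?V)" for f
    by (simp add: envelope_def matrices_carrier)
  define c where "c = (\<lambda>i. unit_vec K (prod_encode (i, 0)))"
  have "\<exists>b\<in>carrier ?E. a \<noteq> \<zero>\<^bsub>A\<^esub> \<longrightarrow> b \<otimes>\<^bsub>?E\<^esub> (rep a \<otimes>\<^bsub>?E\<^esub> c) = ?id"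
    if "a \<in> carrier A" for a
    using rep_divides_one[OF that] E.M.zero_closed unfolding envelope_def c_def by metis
  then obtain b where bE: "\<And>a. a \<in> carrier A \<Longrightarrow> b a \<in> carrier ?E"
    and b: "\<And>a. a \<in> carrier A \<Longrightarrow> a \<noteq> \<zero>\<^bsub>A\<^esub> \<Longrightarrow> b a \<otimes>\<^bsub>?E\<^esub> (rep a \<otimes>\<^bsub>?E\<^esub> c) = ?id"
    by metis
  define X where "X = {?id, c} \<union> rep ` carrier A \<union> b ` carrier A"
  have "X \<subseteq> carrier ?E"
    using bE by (auto simp: X_def c_def E_carrier)
  moreover have X: "range (from_nat_into X) = X"
    using countA by (intro range_from_nat_into) (auto simp: X_def)
  ultimately have "from_nat_into X n \<in> carrier ?E" for n by blast
  then obtain z y where z: "z \<in> carrier ?E" and y: "y \<in> carrier ?E"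
    and gen: "\<And>S. \<lbrakk>z \<in> S; y \<in> S; \<And>f g. f \<in> S \<Longrightarrow> g \<in> S \<Longrightarrow> f \<otimes>\<^bsub>?E\<^esub> g \<in> S\<rbrakk> \<Longrightarrow> X \<subseteq> S"
    using A.matrices_two_generators[of "from_nat_into X"] X unfolding envelope_def by metis
  define C where "C = omega_span K Om ar ?E {z, y}"
  have C: "omega_subalgebra K Om ar ?E C"
    unfolding C_def using z y by (intro E.omega_subalgebra_span) auto
  have zyC: "z \<in> C" "y \<in> C" by (auto simp: C_def omega_span_def)
  with gen omega_subalgebra_mult[OF C] have XC: "X \<subseteq> C" by blast
  have CE: "C \<subseteq> carrier ?E" using E.submoduleE(1)[OF omega_subalgebra_submodule[OF C]] .
  let ?C = "?E\<lparr>carrier := C\<rparr>"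
  interpret C: omega_algebra K Om ar ?C using C by (rule E.omega_subalgebra_algebra)
  have countC: "countable (carrier ?C)"
    using E.countable_omega_span[OF assms(2,3), of "{z, y}"] z y by (simp add: C_def)
  have oneC: "?id \<in> carrier ?C" and cC: "c \<in> carrier ?C"
    and repC: "\<And>a. a \<in> carrier A \<Longrightarrow> rep a \<in> carrier ?C"
    and bC: "\<And>a. a \<in> carrier A \<Longrightarrow> b a \<in> carrier ?C"
    using XC by (auto simp: X_def)
  have one_ne: "?id \<noteq> \<zero>\<^bsub>?C\<^esub>"
    by (auto simp: envelope_def vectors_sel unit_vec_def fun_eq_iff)
  have unit: "f \<otimes>\<^bsub>?C\<^esub> ?id = f" if "f \<in> carrier ?C" for f
    using that CE by (auto simp: envelope_def matrices_carrier)
  obtain M where M: "omega_ideal K Om ar ?C M" "?id \<notin> M"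
    and max: "\<And>I. omega_ideal K Om ar ?C I \<Longrightarrow> M \<subseteq> I \<Longrightarrow> I = M \<or> I = carrier ?C"
    using C.ex_maximal_omega_ideal[OF oneC one_ne unit] by metis
  obtain B :: "('k, nat, 'o) omega_algebra" and h
    where B: "omega_algebra K Om ar B" and h: "h \<in> omega_hom K Om ar ?C B"
      and surj: "h ` carrier ?C = carrier B"
      and h_eq: "\<And>x y. x \<in> carrier ?C \<Longrightarrow> y \<in> carrier ?C \<Longrightarrow> h x = h y \<longleftrightarrow> x \<ominus>\<^bsub>?C\<^esub> y \<in> M"
    using C.countable_omega_quotient[OF countC M(1)] by metis
  interpret B: omega_algebra K Om ar B by fact
  have h0: "h \<zero>\<^bsub>?C\<^esub> = \<zero>\<^bsub>B\<^esub>"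
    by (rule linear_map_zero[OF C.module_axioms B.module_axioms omega_hom_linear[OF h]])
  have ker: "h x = \<zero>\<^bsub>B\<^esub> \<longleftrightarrow> x \<in> M" if "x \<in> carrier ?C" for x
  proof -
    have "x \<ominus>\<^bsub>?C\<^esub> \<zero>\<^bsub>?C\<^esub> = x"
      using that by (rule C.M.diff_zero)
    then show ?thesis using h_eq[OF that C.M.zero_closed] h0 by simp
  qed
  have "omega_simple K Om ar B"
    unfolding omega_simple_def
  proof (intro conjI allI impI)
    have "h ?id \<otimes>\<^bsub>B\<^esub> h ?id = h ?id"
      using omega_hom_mult[OF h oneC oneC] unit[OF oneC] by simp
    then have "h ?id \<otimes>\<^bsub>B\<^esub> h ?id \<noteq> \<zero>\<^bsub>B\<^esub>" using ker[OF oneC] M(2) by simp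
    with oneC surj show "\<exists>x\<in>carrier B. \<exists>y\<in>carrier B. x \<otimes>\<^bsub>B\<^esub> y \<noteq> \<zero>\<^bsub>B\<^esub>" by blast
    fix J assume J: "omega_ideal K Om ar B J"
    let ?I = "{x \<in> carrier ?C. h x \<in> J}"
    have "omega_ideal K Om ar ?C ?I"
      using C.omega_algebra_axioms B h J by (rule omega_ideal_vimage)
    moreover
    have J0: "\<zero>\<^bsub>B\<^esub> \<in> J" using B.submodule_zero[OF omega_ideal_submodule[OF J]] .
    have MC: "M \<subseteq> carrier ?C" using C.submoduleE(1)[OF omega_ideal_submodule[OF M(1)]] .
    have "h x = \<zero>\<^bsub>B\<^esub>" if "x \<in> M" for x using ker[of x] MC that by blast
    with MC J0 have "M \<subseteq> ?I" by auto
    ultimately have "?I = M \<or> ?I = carrier ?C" by (rule max)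
    moreover have JB: "J \<subseteq> h ` carrier ?C"
      using B.submoduleE(1)[OF omega_ideal_submodule[OF J]] surj by simp
    moreover have "J \<subseteq> {\<zero>\<^bsub>B\<^esub>}" if "?I = M" using that JB ker by blast
    moreover have "carrier B \<subseteq> J" if "?I = carrier ?C"
    proof (unfold surj[symmetric], rule image_subsetI)
      show "h x \<in> J" if "x \<in> carrier ?C" for x
        using that \<open>?I = carrier ?C\<close> by blast
    qed
    ultimately show "J = {\<zero>\<^bsub>B\<^esub>} \<or> J = carrier B" using J0 surj by blast
  qed
  moreover have "omega_generates K Om ar B {h z, h y}"
  proof -
    have "carrier B \<subseteq> S" if S: "omega_subalgebra K Om ar B S" "{h z, h y} \<subseteq> S" for S
    proof -
      have "omega_subalgebra K Om ar ?C {x \<in> carrier ?C. h x \<in> S}"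
        using C.omega_algebra_axioms B h S(1) by (rule omega_subalgebra_vimage)
      then have "omega_subalgebra K Om ar ?E {x \<in> carrier ?C. h x \<in> S}"
        by (rule E.omega_subalgebra_trans[OF C])
      moreover have "{z, y} \<subseteq> {x \<in> carrier ?C. h x \<in> S}" using zyC S(2) by simp
      ultimately have "C \<subseteq> {x \<in> carrier ?C. h x \<in> S}" unfolding C_def omega_span_def by blast
      then show ?thesis unfolding surj[symmetric] by auto
    qed
    moreover have "{h z, h y} \<subseteq> carrier B" using zyC surj by auto
    moreover have "omega_span K Om ar B {h z, h y} \<subseteq> carrier B"
      using B.submoduleE(1)[OF omega_subalgebra_submodule[OF B.omega_subalgebra_span]] calculation(2) .
    ultimately show ?thesis unfolding omega_generates_def omega_span_def by blast
  qed
  moreover have "rep \<in> omega_hom K Om ar A ?C"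
    using rep_hom repC unfolding omega_hom_def by simp
  then have hom: "h \<circ> rep \<in> omega_hom K Om ar A B" using h by (rule omega_hom_comp)
  moreover have "inj_on (h \<circ> rep) (carrier A)"
  proof (rule inj_onI)
    fix a a' assume a: "a \<in> carrier A" "a' \<in> carrier A" and eq: "(h \<circ> rep) a = (h \<circ> rep) a'"
    let ?d = "a \<ominus>\<^bsub>A\<^esub> a'"
    have d: "?d \<in> carrier A" using a by simp
    have "(h \<circ> rep) ?d = \<zero>\<^bsub>B\<^esub>"
      using a eq linear_map_closed[OF omega_hom_linear[OF hom] a(1)]
        linear_map_minus[OF A.module_axioms B.module_axioms omega_hom_linear[OF hom] a]
      by (simp add: a_minus_def B.M.r_neg)
    then have "rep ?d \<in> M" using ker[OF repC[OF d]] by simp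
    then have "b ?d \<otimes>\<^bsub>?C\<^esub> (rep ?d \<otimes>\<^bsub>?C\<^esub> c) \<in> M"
      by (intro omega_ideal_mult_left[OF M(1)] omega_ideal_mult_right[OF M(1)] cC bC[OF d])
    then have "?d = \<zero>\<^bsub>A\<^esub>" using b[OF d] M(2) by (cases "?d = \<zero>\<^bsub>A\<^esub>") auto
    then show "a = a'" using A.M.minus_eq_zero_iff[OF a] by simp
  qed
  ultimately show ?thesis using B by blast
qed

end
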